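(* Let $M=\{0\to1\}\times\{0\to1\}$, with its four objects named $a,b,c,d$, so that the category is the commutative square with top morphism $a\to b$, bottom morphism $c\to d$, left morphism $a\to c$, right morphism $b\to d$, and diagonal $a\to d$. Let $M_1$, $M_2$ and $M_3$ be the following three model category structures on $M$. (i) $M_1$: the bottom morphism $c\to d$ is an acyclic cofibration (and not a fibration), while the top morphism $a\to b$ and the two vertical morphisms $a\to c$ and $b\to d$ are each both a cofibration and a fibration, and are not weak equivalences. (Consequently every morphism is a cofibration, the weak equivalences are the identities and $c\to d$, and the fibrations are all morphisms except $c\to d$.) (ii) $M_2$: the top and bottom morphisms $a\to b$ and $c\to d$ are acyclic cofibrations (and not fibrations), and the two vertical morphisms $a\to c$ and $b\to d$ are acyclic fibrations (and not cofibrations). (Consequently every morphism is a weak equivalence, the cofibrations are the identities, $a\to b$ and $c\to d$, and the fibrations are the identities, $a\to c$ and $b\to d$.) (iii) $M_3$: every morphism is an acyclic cofibration. Then $M_1$ and $M_2$ have no greatest lower bound (meet) in the poset of model category structures on $M$, ordered by inclusion of the cofibrations and the acyclic cofibrations. Moreover, the diagram $M_1\to M_3\leftarrow M_2$ formed by the identity functors (which are left Quillen functors) does not admit a limit (pullback) in the 2-category of combinatorial model categories. Hence the 2-category of combinatorial model categories is not complete, even when only limits in the 2-categorical sense are required.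
   Context: A model category is a complete and cocomplete category with classes $\mathsf W,\mathsf C,\mathsf F$ of morphisms (weak equivalences, cofibrations, fibrations) such that $(\mathsf C,\mathsf F\cap\mathsf W)$ and $(\mathsf C\cap\mathsf W,\mathsf F)$ are weak factorization systems and $\mathsf W$ satisfies two-out-of-three. Morphisms in $\mathsf C\cap\mathsf W$ are called acyclic cofibrations and morphisms in $\mathsf F\cap\mathsf W$ are called acyclic fibrations. A model category is combinatorial if its underlying category is locally presentable and both weak factorization systems are generated by sets of morphisms. The 2-category of combinatorial model categories has left Quillen functors (left adjoints preserving cofibrations and acyclic cofibrations) as 1-morphisms and all natural transformations as 2-morphisms. Limits are taken in the 2-categorical sense (also called bilimits): a cone with vertex $Y$ on a diagram $(X_k)_{k\in K}$ (commuting up to specified coherent isomorphism) is a limit if for every object $Z$ the induced functor $\mathrm{Hom}(Z,Y)\to\lim_{k}\mathrm{Hom}(Z,X_k)$ to the pseudolimit of categories is an equivalence of categories. *)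

theory Defs
  imports "HOL-Library.FuncSet" "HOL-Library.Equipollence" "HOL-Library.Countable_Set"
    "HOL-Algebra.Order"
begin

section \<open>Size\<close>

text \<open>
  A type \<open>'u\<close> plays the role of the universe. Subsets of \<open>'u\<close> are the (possibly large)
  classes, and a subset is small if its cardinality is strictly below that of \<open>'u\<close>. If the
  cardinality \<open>\<kappa>\<close> of \<open>'u\<close> is inaccessible, this is the usual notion for the Grothendieck
  universe of sets of rank below \<open>\<kappa>\<close>, whose subsets are also the subsets of \<open>'u\<close> up to
  bijection. The definitions make sense for every \<open>'u\<close>; if \<open>'u\<close> is uncountable, then
  \<open>\<aleph>\<^sub>0\<close> is small, so that small infinite regular cardinals exist.
\<close>

definition small :: "'u set \<Rightarrow> bool" where
  "small A \<longleftrightarrow> A \<prec> (UNIV :: 'u set)"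

section \<open>Categories\<close>

record ('o, 'm) cat =
  Obj :: "'o set"
  Arr :: "'m set"
  Dom :: "'m \<Rightarrow> 'o"
  Cod :: "'m \<Rightarrow> 'o"
  Ide :: "'o \<Rightarrow> 'm"
  Comp :: "'m \<Rightarrow> 'm \<Rightarrow> 'm"  \<comment> \<open>\<open>Comp C g f\<close> is \<open>g\<close> after \<open>f\<close>\<close>

definition homset :: "('o, 'm) cat \<Rightarrow> 'o \<Rightarrow> 'o \<Rightarrow> 'm set" where
  "homset C x y = {f \<in> Arr C. Dom C f = x \<and> Cod C f = y}"

definition category :: "('o, 'm) cat \<Rightarrow> bool" where
  "category C \<longleftrightarrow>
     (\<forall>f\<in>Arr C. Dom C f \<in> Obj C \<and> Cod C f \<in> Obj C) \<and>
     (\<forall>x\<in>Obj C. Ide C x \<in> homset C x x) \<and>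
     (\<forall>f\<in>Arr C. \<forall>g\<in>Arr C. Cod C f = Dom C g \<longrightarrow> Comp C g f \<in> homset C (Dom C f) (Cod C g)) \<and>
     (\<forall>f\<in>Arr C. Comp C f (Ide C (Dom C f)) = f \<and> Comp C (Ide C (Cod C f)) f = f) \<and>
     (\<forall>f\<in>Arr C. \<forall>g\<in>Arr C. \<forall>h\<in>Arr C. Cod C f = Dom C g \<and> Cod C g = Dom C h \<longrightarrow>
        Comp C h (Comp C g f) = Comp C (Comp C h g) f)"

definition small_category :: "('u, 'u) cat \<Rightarrow> bool" where
  "small_category C \<longleftrightarrow> category C \<and> small (Obj C) \<and> small (Arr C)"

definition locally_small :: "('u, 'u) cat \<Rightarrow> bool" where
  "locally_small C \<longleftrightarrow> (\<forall>x\<in>Obj C. \<forall>y\<in>Obj C. small (homset C x y))"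

definition iso_arr :: "('o, 'm) cat \<Rightarrow> 'm \<Rightarrow> bool" where
  "iso_arr C f \<longleftrightarrow> f \<in> Arr C \<and>
     (\<exists>g\<in>homset C (Cod C f) (Dom C f).
        Comp C g f = Ide C (Dom C f) \<and> Comp C f g = Ide C (Cod C f))"

definition isomorphic_objs :: "('o, 'm) cat \<Rightarrow> 'o \<Rightarrow> 'o \<Rightarrow> bool" where
  "isomorphic_objs C x y \<longleftrightarrow> (\<exists>f\<in>homset C x y. iso_arr C f)"

text \<open>A partially ordered set \<open>(A, r)\<close> as a category: the arrows are the pairs in \<open>r\<close>.\<close>

definition poset_cat :: "'a set \<Rightarrow> 'a rel \<Rightarrow> ('a, 'a \<times> 'a) cat" where
  "poset_cat A r =
     \<lparr>Obj = A, Arr = r, Dom = fst, Cod = snd, Ide = (\<lambda>x. (x, x)), Comp = (\<lambda>g f. (fst f, snd g))\<rparr>"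

definition prod_cat :: "('o, 'm) cat \<Rightarrow> ('p, 'n) cat \<Rightarrow> ('o \<times> 'p, 'm \<times> 'n) cat" where
  "prod_cat C D =
     \<lparr>Obj = Obj C \<times> Obj D, Arr = Arr C \<times> Arr D,
      Dom = map_prod (Dom C) (Dom D), Cod = map_prod (Cod C) (Cod D),
      Ide = map_prod (Ide C) (Ide D),
      Comp = (\<lambda>g f. (Comp C (fst g) (fst f), Comp D (snd g) (snd f)))\<rparr>"

definition full_subcat :: "('o, 'm) cat \<Rightarrow> 'o set \<Rightarrow> ('o, 'm) cat" where
  "full_subcat C S =
     C\<lparr>Obj := Obj C \<inter> S, Arr := {f \<in> Arr C. Dom C f \<in> S \<and> Cod C f \<in> S}\<rparr>"

section \<open>Functors and natural transformations\<close>

text \<open>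
  Functors and natural transformations are taken to be \<^const>\<open>undefined\<close> outside their domains,
  so that equality in HOL is equality of functors and of natural transformations.
\<close>

record ('o, 'm, 'p, 'n) func =
  FOb :: "'o \<Rightarrow> 'p"
  FAr :: "'m \<Rightarrow> 'n"

definition is_functor :: "('o, 'm) cat \<Rightarrow> ('p, 'n) cat \<Rightarrow> ('o, 'm, 'p, 'n) func \<Rightarrow> bool" where
  "is_functor C D F \<longleftrightarrow>
     FOb F \<in> Obj C \<rightarrow>\<^sub>E Obj D \<and> FAr F \<in> Arr C \<rightarrow>\<^sub>E Arr D \<and>
     (\<forall>f\<in>Arr C. FAr F f \<in> homset D (FOb F (Dom C f)) (FOb F (Cod C f))) \<and>
     (\<forall>x\<in>Obj C. FAr F (Ide C x) = Ide D (FOb F x)) \<and>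
     (\<forall>f\<in>Arr C. \<forall>g\<in>Arr C. Cod C f = Dom C g \<longrightarrow>
        FAr F (Comp C g f) = Comp D (FAr F g) (FAr F f))"

definition id_functor :: "('o, 'm) cat \<Rightarrow> ('o, 'm, 'o, 'm) func" where
  "id_functor C = \<lparr>FOb = (\<lambda>x\<in>Obj C. x), FAr = (\<lambda>f\<in>Arr C. f)\<rparr>"

definition comp_functor ::
  "('o, 'm) cat \<Rightarrow> ('p, 'n, 'q, 'k) func \<Rightarrow> ('o, 'm, 'p, 'n) func \<Rightarrow> ('o, 'm, 'q, 'k) func" where
  "comp_functor C G F =
     \<lparr>FOb = (\<lambda>x\<in>Obj C. FOb G (FOb F x)), FAr = (\<lambda>f\<in>Arr C. FAr G (FAr F f))\<rparr>"

definition iso_functor :: "('o, 'm) cat \<Rightarrow> ('p, 'n) cat \<Rightarrow> ('o, 'm, 'p, 'n) func \<Rightarrow> bool" where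
  "iso_functor C D F \<longleftrightarrow> is_functor C D F \<and>
     (\<exists>G. is_functor D C G \<and>
        comp_functor C G F = id_functor C \<and> comp_functor D F G = id_functor D)"

record ('o, 'm, 'p, 'n) nt =
  NDom :: "('o, 'm, 'p, 'n) func"
  NCod :: "('o, 'm, 'p, 'n) func"
  NMap :: "'o \<Rightarrow> 'n"

definition nat_trans :: "('o, 'm) cat \<Rightarrow> ('p, 'n) cat \<Rightarrow> ('o, 'm, 'p, 'n) nt \<Rightarrow> bool" where
  "nat_trans C D t \<longleftrightarrow>
     is_functor C D (NDom t) \<and> is_functor C D (NCod t) \<and>
     NMap t \<in> extensional (Obj C) \<and>
     (\<forall>x\<in>Obj C. NMap t x \<in> homset D (FOb (NDom t) x) (FOb (NCod t) x)) \<and>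
     (\<forall>f\<in>Arr C. Comp D (NMap t (Cod C f)) (FAr (NDom t) f) =
                Comp D (FAr (NCod t) f) (NMap t (Dom C f)))"

definition functor_cat ::
  "('o, 'm) cat \<Rightarrow> ('p, 'n) cat \<Rightarrow> (('o, 'm, 'p, 'n) func, ('o, 'm, 'p, 'n) nt) cat" where
  "functor_cat C D =
     \<lparr>Obj = {F. is_functor C D F}, Arr = {t. nat_trans C D t}, Dom = NDom, Cod = NCod,
      Ide = (\<lambda>F. \<lparr>NDom = F, NCod = F, NMap = (\<lambda>x\<in>Obj C. Ide D (FOb F x))\<rparr>),
      Comp = (\<lambda>t s. \<lparr>NDom = NDom s, NCod = NCod t,
                     NMap = (\<lambda>x\<in>Obj C. Comp D (NMap t x) (NMap s x))\<rparr>)\<rparr>"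

text \<open>The horizontal composite of \<open>t : F \<Rightarrow> F'\<close>, for functors from \<open>B\<close> to \<open>C\<close>, and
  \<open>s : G \<Rightarrow> G'\<close>, for functors from \<open>C\<close> to \<open>D\<close>.\<close>

definition nt_hcomp ::
  "('o, 'm) cat \<Rightarrow> ('q, 'k) cat \<Rightarrow> ('p, 'n, 'q, 'k) nt \<Rightarrow> ('o, 'm, 'p, 'n) nt \<Rightarrow>
   ('o, 'm, 'q, 'k) nt" where
  "nt_hcomp B D s t =
     \<lparr>NDom = comp_functor B (NDom s) (NDom t), NCod = comp_functor B (NCod s) (NCod t),
      NMap = (\<lambda>x\<in>Obj B. Comp D (FAr (NCod s) (NMap t x)) (NMap s (FOb (NDom t) x)))\<rparr>"

definition is_equivalence :: "('o, 'm) cat \<Rightarrow> ('p, 'n) cat \<Rightarrow> ('o, 'm, 'p, 'n) func \<Rightarrow> bool" where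
  "is_equivalence C D F \<longleftrightarrow> is_functor C D F \<and>
     (\<exists>G. is_functor D C G \<and>
        isomorphic_objs (functor_cat C C) (comp_functor C G F) (id_functor C) \<and>
        isomorphic_objs (functor_cat D D) (comp_functor D F G) (id_functor D))"

text \<open>Adjunctions are given by unit and counit subject to the triangle identities.\<close>

definition adjunction ::
  "('o, 'm) cat \<Rightarrow> ('p, 'n) cat \<Rightarrow> ('o, 'm, 'p, 'n) func \<Rightarrow> ('p, 'n, 'o, 'm) func \<Rightarrow>
   ('o, 'm, 'o, 'm) nt \<Rightarrow> ('p, 'n, 'p, 'n) nt \<Rightarrow> bool" where
  "adjunction C D F G \<eta> \<epsilon> \<longleftrightarrow>
     is_functor C D F \<and> is_functor D C G \<and>
     \<eta> \<in> homset (functor_cat C C) (id_functor C) (comp_functor C G F) \<and>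
     \<epsilon> \<in> homset (functor_cat D D) (comp_functor D F G) (id_functor D) \<and>
     (\<forall>x\<in>Obj C. Comp D (NMap \<epsilon> (FOb F x)) (FAr F (NMap \<eta> x)) = Ide D (FOb F x)) \<and>
     (\<forall>y\<in>Obj D. Comp C (FAr G (NMap \<epsilon> y)) (NMap \<eta> (FOb G y)) = Ide C (FOb G y))"

definition left_adjoint :: "('o, 'm) cat \<Rightarrow> ('p, 'n) cat \<Rightarrow> ('o, 'm, 'p, 'n) func \<Rightarrow> bool" where
  "left_adjoint C D F \<longleftrightarrow> (\<exists>G \<eta> \<epsilon>. adjunction C D F G \<eta> \<epsilon>)"

section \<open>Limits and colimits in a category\<close>

definition is_cone ::
  "('o, 'm) cat \<Rightarrow> ('j, 'k) cat \<Rightarrow> ('j, 'k, 'o, 'm) func \<Rightarrow> 'o \<Rightarrow> ('j \<Rightarrow> 'm) \<Rightarrow> bool" where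
  "is_cone C J D x p \<longleftrightarrow> x \<in> Obj C \<and> (\<forall>j\<in>Obj J. p j \<in> homset C x (FOb D j)) \<and>
     (\<forall>u\<in>Arr J. Comp C (FAr D u) (p (Dom J u)) = p (Cod J u))"

definition is_limit ::
  "('o, 'm) cat \<Rightarrow> ('j, 'k) cat \<Rightarrow> ('j, 'k, 'o, 'm) func \<Rightarrow> 'o \<Rightarrow> ('j \<Rightarrow> 'm) \<Rightarrow> bool" where
  "is_limit C J D x p \<longleftrightarrow> is_cone C J D x p \<and>
     (\<forall>y q. is_cone C J D y q \<longrightarrow>
        (\<exists>!h. h \<in> homset C y x \<and> (\<forall>j\<in>Obj J. Comp C (p j) h = q j)))"

definition is_cocone ::
  "('o, 'm) cat \<Rightarrow> ('j, 'k) cat \<Rightarrow> ('j, 'k, 'o, 'm) func \<Rightarrow> 'o \<Rightarrow> ('j \<Rightarrow> 'm) \<Rightarrow> bool" where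
  "is_cocone C J D x i \<longleftrightarrow> x \<in> Obj C \<and> (\<forall>j\<in>Obj J. i j \<in> homset C (FOb D j) x) \<and>
     (\<forall>u\<in>Arr J. Comp C (i (Cod J u)) (FAr D u) = i (Dom J u))"

definition is_colimit ::
  "('o, 'm) cat \<Rightarrow> ('j, 'k) cat \<Rightarrow> ('j, 'k, 'o, 'm) func \<Rightarrow> 'o \<Rightarrow> ('j \<Rightarrow> 'm) \<Rightarrow> bool" where
  "is_colimit C J D x i \<longleftrightarrow> is_cocone C J D x i \<and>
     (\<forall>y q. is_cocone C J D y q \<longrightarrow>
        (\<exists>!h. h \<in> homset C x y \<and> (\<forall>j\<in>Obj J. Comp C h (i j) = q j)))"

definition complete_cat :: "('u, 'u) cat \<Rightarrow> bool" where
  "complete_cat C \<longleftrightarrow>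
     (\<forall>(J :: ('u, 'u) cat) D. small_category J \<and> is_functor J C D \<longrightarrow> (\<exists>x p. is_limit C J D x p))"

definition cocomplete_cat :: "('u, 'u) cat \<Rightarrow> bool" where
  "cocomplete_cat C \<longleftrightarrow>
     (\<forall>(J :: ('u, 'u) cat) D. small_category J \<and> is_functor J C D \<longrightarrow> (\<exists>x i. is_colimit C J D x i))"

section \<open>Locally presentable categories\<close>

text \<open>The category of small sets.\<close>

definition set_cat :: "('u set, 'u set \<times> 'u set \<times> ('u \<Rightarrow> 'u)) cat" where
  "set_cat =
     \<lparr>Obj = {A. small A}, Arr = {(A, B, f). small A \<and> small B \<and> f \<in> A \<rightarrow>\<^sub>E B},
      Dom = (\<lambda>(A, B, f). A), Cod = (\<lambda>(A, B, f). B), Ide = (\<lambda>A. (A, A, \<lambda>x\<in>A. x)),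
      Comp = (\<lambda>(A', C, g) (A, B, f). (A, C, compose A g f))\<rparr>"

definition hom_functor ::
  "('u, 'u) cat \<Rightarrow> 'u \<Rightarrow> ('u, 'u, 'u set, 'u set \<times> 'u set \<times> ('u \<Rightarrow> 'u)) func" where
  "hom_functor C k =
     \<lparr>FOb = (\<lambda>x\<in>Obj C. homset C k x),
      FAr = (\<lambda>f\<in>Arr C. (homset C k (Dom C f), homset C k (Cod C f),
                        \<lambda>g\<in>homset C k (Dom C f). Comp C f g))\<rparr>"

text \<open>
  An infinite regular cardinal \<open>\<lambda>\<close> that is small is represented by a cardinal order on a small
  subset of \<open>'u\<close>; a set \<open>B\<close> has fewer than \<open>\<lambda>\<close> elements if \<open>B \<prec> Field \<lambda>\<close>.
\<close>

definition small_regular_cardinal :: "'u rel \<Rightarrow> bool" where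
  "small_regular_cardinal l \<longleftrightarrow>
     Card_order l \<and> infinite (Field l) \<and> regularCard l \<and> small (Field l)"

definition directed_poset :: "'u rel \<Rightarrow> 'u set \<Rightarrow> 'u rel \<Rightarrow> bool" where
  "directed_poset l A r \<longleftrightarrow> partial_order_on A r \<and>
     (\<forall>B\<subseteq>A. B \<prec> Field l \<longrightarrow> (\<exists>x\<in>A. \<forall>y\<in>B. (y, x) \<in> r))"

definition presentable :: "'u rel \<Rightarrow> ('u, 'u) cat \<Rightarrow> 'u \<Rightarrow> bool" where
  "presentable l C k \<longleftrightarrow> k \<in> Obj C \<and>
     (\<forall>A r D x i. small A \<and> directed_poset l A r \<and> is_functor (poset_cat A r) C D \<and>
        is_colimit C (poset_cat A r) D x i \<longrightarrow>
        is_colimit set_cat (poset_cat A r) (comp_functor (poset_cat A r) (hom_functor C k) D)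
          (FOb (hom_functor C k) x) (\<lambda>j. FAr (hom_functor C k) (i j)))"

definition locally_presentable :: "('u, 'u) cat \<Rightarrow> bool" where
  "locally_presentable C \<longleftrightarrow> category C \<and> locally_small C \<and> cocomplete_cat C \<and>
     (\<exists>l. small_regular_cardinal l \<and>
        (\<exists>S. small S \<and> (\<forall>s\<in>S. presentable l C s) \<and>
           (\<forall>x\<in>Obj C. \<exists>A r D i. small A \<and> directed_poset l A r \<and>
              is_functor (poset_cat A r) C D \<and> (\<forall>j\<in>A. FOb D j \<in> S) \<and>
              is_colimit C (poset_cat A r) D x i)))"

section \<open>Model categories\<close>

definition has_lifting :: "('o, 'm) cat \<Rightarrow> 'm \<Rightarrow> 'm \<Rightarrow> bool" where
  "has_lifting C l r \<longleftrightarrow>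
     (\<forall>u\<in>homset C (Dom C l) (Dom C r). \<forall>v\<in>homset C (Cod C l) (Cod C r).
        Comp C r u = Comp C v l \<longrightarrow>
        (\<exists>h\<in>homset C (Cod C l) (Dom C r). Comp C h l = u \<and> Comp C r h = v))"

definition llp :: "('o, 'm) cat \<Rightarrow> 'm set \<Rightarrow> 'm set" where
  "llp C R = {l \<in> Arr C. \<forall>r\<in>R. has_lifting C l r}"

definition rlp :: "('o, 'm) cat \<Rightarrow> 'm set \<Rightarrow> 'm set" where
  "rlp C L = {r \<in> Arr C. \<forall>l\<in>L. has_lifting C l r}"

definition weak_factorization_system :: "('o, 'm) cat \<Rightarrow> 'm set \<Rightarrow> 'm set \<Rightarrow> bool" where
  "weak_factorization_system C L R \<longleftrightarrow> L = llp C R \<and> R = rlp C L \<and>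
     (\<forall>f\<in>Arr C. \<exists>l\<in>L. \<exists>r\<in>R. Cod C l = Dom C r \<and> f = Comp C r l)"

definition two_out_of_three :: "('o, 'm) cat \<Rightarrow> 'm set \<Rightarrow> bool" where
  "two_out_of_three C W \<longleftrightarrow>
     (\<forall>f\<in>Arr C. \<forall>g\<in>Arr C. Cod C f = Dom C g \<longrightarrow>
        (f \<in> W \<and> g \<in> W \<longrightarrow> Comp C g f \<in> W) \<and>
        (f \<in> W \<and> Comp C g f \<in> W \<longrightarrow> g \<in> W) \<and>
        (g \<in> W \<and> Comp C g f \<in> W \<longrightarrow> f \<in> W))"

record 'm mstruct =
  Weq :: "'m set"
  Cof :: "'m set"
  Fib :: "'m set"

definition Acof :: "'m mstruct \<Rightarrow> 'm set" where
  "Acof S = Cof S \<inter> Weq S"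

definition Afib :: "'m mstruct \<Rightarrow> 'm set" where
  "Afib S = Fib S \<inter> Weq S"

definition model_category :: "('u, 'u) cat \<Rightarrow> 'u mstruct \<Rightarrow> bool" where
  "model_category C S \<longleftrightarrow>
     category C \<and> complete_cat C \<and> cocomplete_cat C \<and>
     Weq S \<subseteq> Arr C \<and> two_out_of_three C (Weq S) \<and>
     weak_factorization_system C (Cof S) (Afib S) \<and>
     weak_factorization_system C (Acof S) (Fib S)"

definition combinatorial_model_category :: "('u, 'u) cat \<Rightarrow> 'u mstruct \<Rightarrow> bool" where
  "combinatorial_model_category C S \<longleftrightarrow>
     model_category C S \<and> locally_presentable C \<and>
     (\<exists>I\<subseteq>Arr C. small I \<and> Afib S = rlp C I) \<and>
     (\<exists>I\<subseteq>Arr C. small I \<and> Fib S = rlp C I)"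

definition model_structure_poset :: "('u, 'u) cat \<Rightarrow> 'u mstruct gorder" where
  "model_structure_poset C =
     \<lparr>carrier = {S. model_category C S}, eq = (=),
      le = (\<lambda>S T. Cof S \<subseteq> Cof T \<and> Acof S \<subseteq> Acof T)\<rparr>"

definition left_quillen ::
  "('u, 'u) cat \<times> 'u mstruct \<Rightarrow> ('u, 'u) cat \<times> 'u mstruct \<Rightarrow> ('u, 'u, 'u, 'u) func \<Rightarrow> bool" where
  "left_quillen X Y F \<longleftrightarrow> left_adjoint (fst X) (fst Y) F \<and>
     FAr F ` Cof (snd X) \<subseteq> Cof (snd Y) \<and> FAr F ` Acof (snd X) \<subseteq> Acof (snd Y)"

section \<open>Limits in a 2-category\<close>

text \<open>The data of a strict 2-category: hom-categories (with vertical composition), identity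
  1-morphisms, and composition of 1-morphisms and horizontal composition of 2-morphisms.
  \<open>Comp1 T X Y Z g f\<close> is \<open>g\<close> after \<open>f\<close>, for \<open>f : X \<rightarrow> Y\<close> and \<open>g : Y \<rightarrow> Z\<close>.\<close>

record ('o, 'f, 't) two_cat =
  Obj2 :: "'o set"
  Hom2 :: "'o \<Rightarrow> 'o \<Rightarrow> ('f, 't) cat"
  Ide1 :: "'o \<Rightarrow> 'f"
  Comp1 :: "'o \<Rightarrow> 'o \<Rightarrow> 'o \<Rightarrow> 'f \<Rightarrow> 'f \<Rightarrow> 'f"
  HComp :: "'o \<Rightarrow> 'o \<Rightarrow> 'o \<Rightarrow> 't \<Rightarrow> 't \<Rightarrow> 't"

definition is_diagram ::
  "('o, 'f, 't) two_cat \<Rightarrow> ('k, 'l) cat \<Rightarrow> ('k, 'l, 'o, 'f) func \<Rightarrow> bool" where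
  "is_diagram T K X \<longleftrightarrow>
     (\<forall>k\<in>Obj K. FOb X k \<in> Obj2 T) \<and>
     (\<forall>u\<in>Arr K. FAr X u \<in> Obj (Hom2 T (FOb X (Dom K u)) (FOb X (Cod K u)))) \<and>
     (\<forall>k\<in>Obj K. FAr X (Ide K k) = Ide1 T (FOb X k)) \<and>
     (\<forall>u\<in>Arr K. \<forall>v\<in>Arr K. Cod K u = Dom K v \<longrightarrow>
        FAr X (Comp K v u) =
        Comp1 T (FOb X (Dom K u)) (FOb X (Cod K u)) (FOb X (Cod K v)) (FAr X v) (FAr X u))"

text \<open>
  The pseudolimit of a diagram of categories \<open>k \<mapsto> A k\<close> and functors
  \<open>F u : A (Dom K u) \<rightarrow> A (Cod K u)\<close>. An object is a family of objects \<open>x k\<close> with isomorphisms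
  \<open>\<theta> u : F u (x (Dom K u)) \<rightarrow> x (Cod K u)\<close> that are coherent with identities and composition;
  a morphism is a family of morphisms commuting with these isomorphisms.
\<close>

record ('k, 'l, 'p, 'n) plobj =
  PlOb :: "'k \<Rightarrow> 'p"
  PlIso :: "'l \<Rightarrow> 'n"

record ('k, 'l, 'p, 'n) plarr =
  PlDom :: "('k, 'l, 'p, 'n) plobj"
  PlCod :: "('k, 'l, 'p, 'n) plobj"
  PlMap :: "'k \<Rightarrow> 'n"

definition is_plobj ::
  "('k, 'l) cat \<Rightarrow> ('k \<Rightarrow> ('p, 'n) cat) \<Rightarrow> ('l \<Rightarrow> ('p, 'n, 'p, 'n) func) \<Rightarrow>
   ('k, 'l, 'p, 'n) plobj \<Rightarrow> bool" where
  "is_plobj K A F x \<longleftrightarrow>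
     PlOb x \<in> (\<Pi>\<^sub>E k\<in>Obj K. Obj (A k)) \<and>
     PlIso x \<in> extensional (Arr K) \<and>
     (\<forall>u\<in>Arr K. iso_arr (A (Cod K u)) (PlIso x u) \<and>
        PlIso x u \<in> homset (A (Cod K u)) (FOb (F u) (PlOb x (Dom K u))) (PlOb x (Cod K u))) \<and>
     (\<forall>k\<in>Obj K. PlIso x (Ide K k) = Ide (A k) (PlOb x k)) \<and>
     (\<forall>u\<in>Arr K. \<forall>v\<in>Arr K. Cod K u = Dom K v \<longrightarrow>
        PlIso x (Comp K v u) = Comp (A (Cod K v)) (PlIso x v) (FAr (F v) (PlIso x u)))"

definition is_plarr ::
  "('k, 'l) cat \<Rightarrow> ('k \<Rightarrow> ('p, 'n) cat) \<Rightarrow> ('l \<Rightarrow> ('p, 'n, 'p, 'n) func) \<Rightarrow>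
   ('k, 'l, 'p, 'n) plarr \<Rightarrow> bool" where
  "is_plarr K A F m \<longleftrightarrow>
     is_plobj K A F (PlDom m) \<and> is_plobj K A F (PlCod m) \<and>
     PlMap m \<in> extensional (Obj K) \<and>
     (\<forall>k\<in>Obj K. PlMap m k \<in> homset (A k) (PlOb (PlDom m) k) (PlOb (PlCod m) k)) \<and>
     (\<forall>u\<in>Arr K. Comp (A (Cod K u)) (PlMap m (Cod K u)) (PlIso (PlDom m) u) =
                Comp (A (Cod K u)) (PlIso (PlCod m) u) (FAr (F u) (PlMap m (Dom K u))))"

definition pseudolim ::
  "('k, 'l) cat \<Rightarrow> ('k \<Rightarrow> ('p, 'n) cat) \<Rightarrow> ('l \<Rightarrow> ('p, 'n, 'p, 'n) func) \<Rightarrow>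
   (('k, 'l, 'p, 'n) plobj, ('k, 'l, 'p, 'n) plarr) cat" where
  "pseudolim K A F =
     \<lparr>Obj = {x. is_plobj K A F x}, Arr = {m. is_plarr K A F m}, Dom = PlDom, Cod = PlCod,
      Ide = (\<lambda>x. \<lparr>PlDom = x, PlCod = x, PlMap = (\<lambda>k\<in>Obj K. Ide (A k) (PlOb x k))\<rparr>),
      Comp = (\<lambda>n m. \<lparr>PlDom = PlDom m, PlCod = PlCod n,
                     PlMap = (\<lambda>k\<in>Obj K. Comp (A k) (PlMap n k) (PlMap m k))\<rparr>)\<rparr>"

definition postcomp ::
  "('o, 'f, 't) two_cat \<Rightarrow> 'o \<Rightarrow> 'o \<Rightarrow> 'o \<Rightarrow> 'f \<Rightarrow> ('f, 't, 'f, 't) func" where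
  "postcomp T Z X X' g =
     \<lparr>FOb = (\<lambda>f\<in>Obj (Hom2 T Z X). Comp1 T Z X X' g f),
      FAr = (\<lambda>t\<in>Arr (Hom2 T Z X). HComp T Z X X' (Ide (Hom2 T X X') g) t)\<rparr>"

text \<open>The category of cones with vertex \<open>Z\<close> on the diagram \<open>X\<close>, that is, the pseudolimit of the
  categories \<open>Hom (Z, X k)\<close>.\<close>

definition cones ::
  "('o, 'f, 't) two_cat \<Rightarrow> ('k, 'l) cat \<Rightarrow> ('k, 'l, 'o, 'f) func \<Rightarrow> 'o \<Rightarrow>
   (('k, 'l, 'f, 't) plobj, ('k, 'l, 'f, 't) plarr) cat" where
  "cones T K X Z =
     pseudolim K (\<lambda>k. Hom2 T Z (FOb X k))
       (\<lambda>u. postcomp T Z (FOb X (Dom K u)) (FOb X (Cod K u)) (FAr X u))"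

text \<open>The functor \<open>Hom (Z, Y) \<rightarrow> cones T K X Z\<close> induced by a cone \<open>c\<close> with vertex \<open>Y\<close>.\<close>

definition restrict_cone ::
  "('o, 'f, 't) two_cat \<Rightarrow> ('k, 'l) cat \<Rightarrow> ('k, 'l, 'o, 'f) func \<Rightarrow> 'o \<Rightarrow>
   ('k, 'l, 'f, 't) plobj \<Rightarrow> 'o \<Rightarrow> 'f \<Rightarrow> ('k, 'l, 'f, 't) plobj" where
  "restrict_cone T K X Y c Z h =
     \<lparr>PlOb = (\<lambda>k\<in>Obj K. Comp1 T Z Y (FOb X k) (PlOb c k) h),
      PlIso = (\<lambda>u\<in>Arr K. HComp T Z Y (FOb X (Cod K u)) (PlIso c u) (Ide (Hom2 T Z Y) h))\<rparr>"

definition induced_functor ::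
  "('o, 'f, 't) two_cat \<Rightarrow> ('k, 'l) cat \<Rightarrow> ('k, 'l, 'o, 'f) func \<Rightarrow> 'o \<Rightarrow>
   ('k, 'l, 'f, 't) plobj \<Rightarrow> 'o \<Rightarrow>
   ('f, 't, ('k, 'l, 'f, 't) plobj, ('k, 'l, 'f, 't) plarr) func" where
  "induced_functor T K X Y c Z =
     \<lparr>FOb = (\<lambda>h\<in>Obj (Hom2 T Z Y). restrict_cone T K X Y c Z h),
      FAr = (\<lambda>t\<in>Arr (Hom2 T Z Y).
        \<lparr>PlDom = restrict_cone T K X Y c Z (Dom (Hom2 T Z Y) t),
         PlCod = restrict_cone T K X Y c Z (Cod (Hom2 T Z Y) t),
         PlMap = (\<lambda>k\<in>Obj K. HComp T Z Y (FOb X k) (Ide (Hom2 T Y (FOb X k)) (PlOb c k)) t)\<rparr>)\<rparr>"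

definition is_bilimit ::
  "('o, 'f, 't) two_cat \<Rightarrow> ('k, 'l) cat \<Rightarrow> ('k, 'l, 'o, 'f) func \<Rightarrow> 'o \<Rightarrow>
   ('k, 'l, 'f, 't) plobj \<Rightarrow> bool" where
  "is_bilimit T K X Y c \<longleftrightarrow> Y \<in> Obj2 T \<and> c \<in> Obj (cones T K X Y) \<and>
     (\<forall>Z\<in>Obj2 T. is_equivalence (Hom2 T Z Y) (cones T K X Z) (induced_functor T K X Y c Z))"

section \<open>The 2-category of combinatorial model categories\<close>

type_synonym 'u model_cat = "('u, 'u) cat \<times> 'u mstruct"
type_synonym 'u endo_func = "('u, 'u, 'u, 'u) func"
type_synonym 'u endo_nt = "('u, 'u, 'u, 'u) nt"

definition CMC :: "('u model_cat, 'u endo_func, 'u endo_nt) two_cat" where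
  "CMC =
     \<lparr>Obj2 = {(C, S). combinatorial_model_category C S},
      Hom2 = (\<lambda>X Y. full_subcat (functor_cat (fst X) (fst Y)) {F. left_quillen X Y F}),
      Ide1 = (\<lambda>X. id_functor (fst X)),
      Comp1 = (\<lambda>X Y Z G F. comp_functor (fst X) G F),
      HComp = (\<lambda>X Y Z s t. nt_hcomp (fst X) (fst Z) s t)\<rparr>"

text \<open>The index categories range over \<open>('u, 'u) cat\<close>, which contains a copy of every small
  category.\<close>

definition CMC_has_bilimits :: "'u itself \<Rightarrow> bool" where
  "CMC_has_bilimits _ \<longleftrightarrow>
     (\<forall>(K :: ('u, 'u) cat) X. small_category K \<and>
        is_diagram (CMC :: ('u model_cat, 'u endo_func, 'u endo_nt) two_cat) K X \<longrightarrow>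
        (\<exists>Y c. is_bilimit CMC K X Y c))"

section \<open>The shapes of the diagrams\<close>

text \<open>The category \<open>{0 \<rightarrow> 1}\<close>, with \<open>0 = False\<close> and \<open>1 = True\<close>.\<close>

definition walking_arrow :: "(bool, bool \<times> bool) cat" where
  "walking_arrow = poset_cat UNIV {(x, y). x \<le> y}"

datatype cospan = Leg1 | Apex | Leg2

text \<open>The category \<open>Leg1 \<rightarrow> Apex \<leftarrow> Leg2\<close>.\<close>

definition walking_cospan :: "(cospan, cospan \<times> cospan) cat" where
  "walking_cospan = poset_cat UNIV {(x, y). x = y \<or> y = Apex}"

definition id_cospan ::
  "('u, 'u) cat \<Rightarrow> 'u mstruct \<Rightarrow> 'u mstruct \<Rightarrow> 'u mstruct \<Rightarrow>
   (cospan, cospan \<times> cospan, 'u model_cat, 'u endo_func) func" where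
  "id_cospan C S1 S2 S3 =
     \<lparr>FOb = case_cospan (C, S1) (C, S3) (C, S2), FAr = (\<lambda>_. id_functor C)\<rparr>"

end

theory Submission
  imports Defs
begin

text \<open>
  The obstruction to a meet is this. The structure \<open>lower1\<close>, with cofibrations \<open>a \<rightarrow> b\<close> and
  \<open>c \<rightarrow> d\<close> and only trivial acyclic cofibrations, and the structure \<open>lower2\<close>, with \<open>c \<rightarrow> d\<close> as the
  only nontrivial cofibration and acyclic cofibration, both lie below \<open>M\<^sub>1\<close> and \<open>M\<^sub>2\<close>. A structure
  that lies above both of them and below \<open>M\<^sub>1\<close> and \<open>M\<^sub>2\<close> has the cofibration \<open>a \<rightarrow> b\<close> and the
  weak equivalence \<open>c \<rightarrow> d\<close>; as all its cofibrations are cofibrations of \<open>M\<^sub>2\<close>, the vertical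
  arrows are acyclic fibrations. Two-out-of-three in the square makes \<open>a \<rightarrow> b\<close> an acyclic
  cofibration, which it is not in \<open>M\<^sub>1\<close>.

  A pullback would produce the same contradiction in its vertex \<open>C\<close>. Testing the universal property
  on \<open>C\<close> with its least model structure (\<open>least_structure\<close>), for which being left Quillen is only
  being a left adjoint, shows that each section of the projection to \<open>M\<close> is inverse to it up to
  isomorphism, provided that it is a left adjoint; in particular the projection reflects
  isomorphisms. Testing on \<open>M\<close> with \<open>lower1\<close> and with \<open>lower2\<close> gives two such sections. They are
  isomorphic, and their properties add up to those of the impossible structure. The lemma
  \<open>no_amalgam\<close> derives the contradiction for a general section, so that it serves for the meet,
  where the section is the identity, and for the bilimit (\<open>no_bilimit\<close>).

  The remaining work is to see that the categories in play are combinatorial model categories. Lifting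
  in a poset is a condition on the order alone, so that the model structures on the square are
  verified by a finite check; and a finite lattice is complete, cocomplete and locally presentable,
  because directed diagrams in it attain their colimits.
\<close>

section \<open>Categories and isomorphisms\<close>

lemma homsetI: "f \<in> Arr C \<Longrightarrow> Dom C f = x \<Longrightarrow> Cod C f = y \<Longrightarrow> f \<in> homset C x y"
  by (simp add: homset_def)

lemma homsetD:
  assumes "f \<in> homset C x y"
  shows "f \<in> Arr C" "Dom C f = x" "Cod C f = y"
  using assms by (simp_all add: homset_def)

lemma homset_obj:
  assumes "category C" "f \<in> homset C x y"
  shows "x \<in> Obj C" "y \<in> Obj C"
  using assms by (auto simp: category_def homset_def)

lemma Dom_obj: "category C \<Longrightarrow> f \<in> Arr C \<Longrightarrow> Dom C f \<in> Obj C"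
  and Cod_obj: "category C \<Longrightarrow> f \<in> Arr C \<Longrightarrow> Cod C f \<in> Obj C"
  by (auto simp: category_def)

lemma Ide_in: "category C \<Longrightarrow> x \<in> Obj C \<Longrightarrow> Ide C x \<in> homset C x x"
  by (simp add: category_def)

lemma Comp_in:
  assumes "category C" "f \<in> homset C x y" "g \<in> homset C y z"
  shows "Comp C g f \<in> homset C x z"
  using assms by (auto simp: category_def homset_def)

lemma Comp_Ide:
  assumes "category C" "f \<in> homset C x y"
  shows "Comp C f (Ide C x) = f" "Comp C (Ide C y) f = f"
  using assms by (auto simp: category_def homset_def)

lemma Comp_assoc:
  assumes "category C" "f \<in> homset C w x" "g \<in> homset C x y" "h \<in> homset C y z"
  shows "Comp C h (Comp C g f) = Comp C (Comp C h g) f"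
  using assms by (auto simp: category_def homset_def)

lemma iso_arrI:
  assumes "f \<in> homset C x y" "g \<in> homset C y x" "Comp C g f = Ide C x" "Comp C f g = Ide C y"
  shows "iso_arr C f"
  using assms by (auto simp: iso_arr_def homset_def)

lemma iso_arrE:
  assumes "iso_arr C f" "f \<in> homset C x y"
  obtains g where "g \<in> homset C y x" "Comp C g f = Ide C x" "Comp C f g = Ide C y"
  using assms by (auto simp: iso_arr_def homset_def)

lemma iso_Ide:
  assumes "category C" "x \<in> Obj C"
  shows "iso_arr C (Ide C x)"
proof -
  have "Ide C x \<in> homset C x x" by (rule Ide_in[OF assms])
  then show ?thesis using Comp_Ide(1)[OF assms(1)] by (blast intro: iso_arrI)
qed

lemma iso_Comp:
  assumes C: "category C" and f: "f \<in> homset C x y" "iso_arr C f"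
    and g: "g \<in> homset C y z" "iso_arr C g"
  shows "iso_arr C (Comp C g f)"
proof -
  obtain f' where f': "f' \<in> homset C y x" "Comp C f' f = Ide C x" "Comp C f f' = Ide C y"
    using f by (auto elim: iso_arrE)
  obtain g' where g': "g' \<in> homset C z y" "Comp C g' g = Ide C y" "Comp C g g' = Ide C z"
    using g by (auto elim: iso_arrE)
  have gf: "Comp C g f \<in> homset C x z" using C f g by (auto intro: Comp_in)
  have fg': "Comp C f' g' \<in> homset C z x" using C f' g' by (auto intro: Comp_in)
  have "Comp C (Comp C f' g') (Comp C g f) = Comp C f' (Comp C (Comp C g' g) f)"
    using Comp_assoc[OF C gf g'(1) f'(1)] Comp_assoc[OF C f(1) g(1) g'(1)] by simp
  also have "\<dots> = Ide C x" using g' f' Comp_Ide[OF C f(1)] by simp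
  finally have 1: "Comp C (Comp C f' g') (Comp C g f) = Ide C x" .
  have "Comp C (Comp C g f) (Comp C f' g') = Comp C g (Comp C (Comp C f f') g')"
    using Comp_assoc[OF C fg' f(1) g(1)] Comp_assoc[OF C g'(1) f'(1) f(1)] by simp
  also have "\<dots> = Ide C z" using g' f' Comp_Ide[OF C g'(1)] by simp
  finally have 2: "Comp C (Comp C g f) (Comp C f' g') = Ide C z" .
  show ?thesis by (rule iso_arrI[OF gf fg' 1 2])
qed

text \<open>In a square whose horizontal sides are invertible, each vertical side is the conjugate of
  the other.\<close>

lemma iso_conjugate:
  assumes C: "category C" and u: "u \<in> homset C x y" and v: "v \<in> homset C x' y'"
    and s: "s \<in> homset C x x'" "iso_arr C s" and t: "t \<in> homset C y y'" "iso_arr C t"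
    and sq: "Comp C t u = Comp C v s"
  shows "iso_arr C u \<longleftrightarrow> iso_arr C v"
proof -
  obtain s' where s': "s' \<in> homset C x' x" "Comp C s' s = Ide C x" "Comp C s s' = Ide C x'"
    using s by (auto elim: iso_arrE)
  obtain t' where t': "t' \<in> homset C y' y" "Comp C t' t = Ide C y" "Comp C t t' = Ide C y'"
    using t by (auto elim: iso_arrE)
  have is': "iso_arr C s'" and it': "iso_arr C t'"
    using iso_arrI[OF s'(1) s(1)] iso_arrI[OF t'(1) t(1)] s' t' by auto
  have tu: "Comp C t u \<in> homset C x y'" and vs: "Comp C v s \<in> homset C x y'"
    using C u v s t by (auto intro: Comp_in)
  have u_eq: "u = Comp C t' (Comp C v s)"
    using Comp_assoc[OF C u t(1) t'(1)] t' Comp_Ide[OF C u] sq by simp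
  have v_eq: "v = Comp C (Comp C t u) s'"
    using Comp_assoc[OF C s'(1) s(1) v] s' Comp_Ide[OF C v] sq by simp
  show ?thesis
  proof
    assume "iso_arr C u"
    then have "iso_arr C (Comp C t u)" using iso_Comp[OF C u _ t] by simp
    then show "iso_arr C v" using v_eq iso_Comp[OF C s'(1) is' tu] by simp
  next
    assume "iso_arr C v"
    then have "iso_arr C (Comp C v s)" using iso_Comp[OF C s v] by simp
    then show "iso_arr C u" using u_eq iso_Comp[OF C vs _ t'(1) it'] by simp
  qed
qed

section \<open>Functors and natural transformations\<close>

lemma functor_ob: "is_functor C D F \<Longrightarrow> x \<in> Obj C \<Longrightarrow> FOb F x \<in> Obj D"
  by (auto simp: is_functor_def)

lemma functor_hom:
  "is_functor C D F \<Longrightarrow> f \<in> homset C x y \<Longrightarrow> FAr F f \<in> homset D (FOb F x) (FOb F y)"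
  by (auto simp: is_functor_def homset_def)

lemma functor_Ide: "is_functor C D F \<Longrightarrow> x \<in> Obj C \<Longrightarrow> FAr F (Ide C x) = Ide D (FOb F x)"
  by (auto simp: is_functor_def)

lemma functor_Comp:
  "is_functor C D F \<Longrightarrow> f \<in> homset C x y \<Longrightarrow> g \<in> homset C y z \<Longrightarrow>
   FAr F (Comp C g f) = Comp D (FAr F g) (FAr F f)"
  by (auto simp: is_functor_def homset_def)

lemma functor_iso:
  assumes C: "category C" and F: "is_functor C D F" and f: "f \<in> homset C x y" "iso_arr C f"
  shows "iso_arr D (FAr F f)"
proof -
  obtain g where g: "g \<in> homset C y x" "Comp C g f = Ide C x" "Comp C f g = Ide C y"
    using f by (auto elim: iso_arrE)
  have xy: "x \<in> Obj C" "y \<in> Obj C" using homset_obj[OF C f(1)] .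
  show ?thesis
    using functor_Comp[OF F f(1) g(1)] functor_Comp[OF F g(1) f(1)] g functor_Ide[OF F] xy
    by (intro iso_arrI[OF functor_hom[OF F f(1)] functor_hom[OF F g(1)]]) auto
qed

lemma functor_eqI:
  fixes F G :: "('o, 'm, 'p, 'n) func"
  assumes "is_functor C D F" "is_functor C D G"
    and "\<And>x. x \<in> Obj C \<Longrightarrow> FOb F x = FOb G x" "\<And>f. f \<in> Arr C \<Longrightarrow> FAr F f = FAr G f"
  shows "F = G"
proof -
  have "FOb F = FOb G" "FAr F = FAr G"
    using assms by (auto simp: is_functor_def intro: PiE_ext)
  then show ?thesis by simp
qed

lemma id_functor_simps [simp]:
  "x \<in> Obj C \<Longrightarrow> FOb (id_functor C) x = x" "f \<in> Arr C \<Longrightarrow> FAr (id_functor C) f = f"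
  by (simp_all add: id_functor_def)

lemma comp_functor_simps [simp]:
  "x \<in> Obj C \<Longrightarrow> FOb (comp_functor C G F) x = FOb G (FOb F x)"
  "f \<in> Arr C \<Longrightarrow> FAr (comp_functor C G F) f = FAr G (FAr F f)"
  by (simp_all add: comp_functor_def)

lemma is_functor_id: "category C \<Longrightarrow> is_functor C C (id_functor C)"
  by (auto simp: is_functor_def id_functor_def category_def homset_def)

lemma is_functor_comp:
  assumes "category B" "is_functor B C F" "is_functor C D G"
  shows "is_functor B D (comp_functor B G F)"
  unfolding is_functor_def
proof (intro conjI ballI impI)
  show "FOb (comp_functor B G F) \<in> Obj B \<rightarrow>\<^sub>E Obj D" "FAr (comp_functor B G F) \<in> Arr B \<rightarrow>\<^sub>E Arr D"
    using assms by (auto simp: is_functor_def comp_functor_def)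
next
  fix f assume f: "f \<in> Arr B"
  have "FAr G (FAr F f) \<in> homset D (FOb G (FOb F (Dom B f))) (FOb G (FOb F (Cod B f)))"
    using functor_hom[OF assms(3) functor_hom[OF assms(2) homsetI[OF f refl refl]]] .
  then show "FAr (comp_functor B G F) f
      \<in> homset D (FOb (comp_functor B G F) (Dom B f)) (FOb (comp_functor B G F) (Cod B f))"
    using f assms(1) by (simp add: Dom_obj Cod_obj)
next
  fix x assume "x \<in> Obj B"
  then show "FAr (comp_functor B G F) (Ide B x) = Ide D (FOb (comp_functor B G F) x)"
    using assms functor_Ide[OF assms(2)] functor_Ide[OF assms(3)] homsetD(1)[OF Ide_in[OF assms(1)]]
    by (simp add: functor_ob)
next
  fix f g assume fg: "f \<in> Arr B" "g \<in> Arr B" "Cod B f = Dom B g"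
  have f: "f \<in> homset B (Dom B f) (Cod B f)" and g: "g \<in> homset B (Cod B f) (Cod B g)"
    using fg by (auto intro: homsetI)
  show "FAr (comp_functor B G F) (Comp B g f)
      = Comp D (FAr (comp_functor B G F) g) (FAr (comp_functor B G F) f)"
    using fg functor_Comp[OF assms(2) f g] homsetD(1)[OF Comp_in[OF assms(1) f g]]
      functor_Comp[OF assms(3) functor_hom[OF assms(2) f] functor_hom[OF assms(2) g]]
    by simp
qed

lemma comp_functor_id: "category C \<Longrightarrow> comp_functor C (id_functor C) (id_functor C) = id_functor C"
  by (auto simp: comp_functor_def id_functor_def)

lemma id_comp_functor:
  assumes "category C" "is_functor C D F" "category D"
  shows "comp_functor C (id_functor D) F = F"
proof (rule functor_eqI[OF is_functor_comp])
  show "FAr (comp_functor C (id_functor D) F) f = FAr F f" if "f \<in> Arr C" for f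
    using that homsetD(1)[OF functor_hom[OF assms(2) homsetI[OF that refl refl]]] by simp
qed (use assms in \<open>auto intro: is_functor_id simp: functor_ob\<close>)

lemma functor_cat_simps [simp]:
  "Obj (functor_cat C D) = {F. is_functor C D F}"
  "Arr (functor_cat C D) = {t. nat_trans C D t}"
  "Dom (functor_cat C D) = NDom" "Cod (functor_cat C D) = NCod"
  "NDom (Ide (functor_cat C D) F) = F" "NCod (Ide (functor_cat C D) F) = F"
  "x \<in> Obj C \<Longrightarrow> NMap (Ide (functor_cat C D) F) x = Ide D (FOb F x)"
  "x \<in> Obj C \<Longrightarrow> NMap (Comp (functor_cat C D) t s) x = Comp D (NMap t x) (NMap s x)"
  by (simp_all add: functor_cat_def)

lemma nt_hom:
  assumes "t \<in> homset (functor_cat C D) F G" "x \<in> Obj C"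
  shows "NMap t x \<in> homset D (FOb F x) (FOb G x)"
  using assms by (auto simp: homset_def nat_trans_def)

lemma nt_natural:
  assumes "t \<in> homset (functor_cat C D) F G" "f \<in> homset C x y"
  shows "Comp D (NMap t y) (FAr F f) = Comp D (FAr G f) (NMap t x)"
  using assms by (auto simp: homset_def nat_trans_def)

lemma nt_functors:
  assumes "t \<in> homset (functor_cat C D) F G"
  shows "is_functor C D F" "is_functor C D G"
  using assms by (auto simp: homset_def nat_trans_def)

lemma nt_homI:
  assumes "is_functor C D F" "is_functor C D G" "m \<in> extensional (Obj C)"
    and "\<And>x. x \<in> Obj C \<Longrightarrow> m x \<in> homset D (FOb F x) (FOb G x)"
    and "\<And>f. f \<in> Arr C \<Longrightarrow> Comp D (m (Cod C f)) (FAr F f) = Comp D (FAr G f) (m (Dom C f))"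
  shows "\<lparr>NDom = F, NCod = G, NMap = m\<rparr> \<in> homset (functor_cat C D) F G"
  using assms by (auto simp: homset_def nat_trans_def)

lemma nt_Ide:
  assumes C: "category C" and D: "category D" and F: "is_functor C D F"
  shows "Ide (functor_cat C D) F \<in> homset (functor_cat C D) F F"
proof -
  have "\<lparr>NDom = F, NCod = F, NMap = (\<lambda>x\<in>Obj C. Ide D (FOb F x))\<rparr> \<in> homset (functor_cat C D) F F"
  proof (rule nt_homI[OF F F])
    fix f assume f: "f \<in> Arr C"
    have "FAr F f \<in> homset D (FOb F (Dom C f)) (FOb F (Cod C f))"
      using functor_hom[OF F homsetI[OF f refl refl]] .
    then show "Comp D ((\<lambda>x\<in>Obj C. Ide D (FOb F x)) (Cod C f)) (FAr F f)
        = Comp D (FAr F f) ((\<lambda>x\<in>Obj C. Ide D (FOb F x)) (Dom C f))"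
      using f C by (simp add: Comp_Ide[OF D] Dom_obj Cod_obj)
  qed (use F D in \<open>auto intro: Ide_in functor_ob\<close>)
  then show ?thesis by (simp add: functor_cat_def)
qed

lemma full_subcat_simps [simp]:
  "Obj (full_subcat C S) = Obj C \<inter> S" "Dom (full_subcat C S) = Dom C"
  "Cod (full_subcat C S) = Cod C" "Ide (full_subcat C S) = Ide C"
  "Comp (full_subcat C S) = Comp C"
  by (simp_all add: full_subcat_def)

lemma homset_full_subcat:
  "f \<in> homset (full_subcat C S) x y \<longleftrightarrow> f \<in> homset C x y \<and> x \<in> S \<and> y \<in> S"
  by (auto simp: full_subcat_def homset_def)

lemma full_subcat_UNIV: "full_subcat C UNIV = C"
  by (simp add: full_subcat_def)

lemma iso_nt_component:
  assumes "iso_arr (full_subcat (functor_cat C D) S) t"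
    and t: "t \<in> homset (full_subcat (functor_cat C D) S) F G" and x: "x \<in> Obj C"
  shows "iso_arr D (NMap t x)"
proof -
  obtain s where s: "s \<in> homset (full_subcat (functor_cat C D) S) G F"
    "Comp (functor_cat C D) s t = Ide (functor_cat C D) F"
    "Comp (functor_cat C D) t s = Ide (functor_cat C D) G"
    using assms(1) iso_arrE[OF assms(1) t] by auto
  have "NMap (Comp (functor_cat C D) s t) x = NMap (Ide (functor_cat C D) F) x"
    "NMap (Comp (functor_cat C D) t s) x = NMap (Ide (functor_cat C D) G) x"
    using s by simp_all
  then have "Comp D (NMap s x) (NMap t x) = Ide D (FOb F x)"
    "Comp D (NMap t x) (NMap s x) = Ide D (FOb G x)" using x by simp_all
  moreover have "NMap t x \<in> homset D (FOb F x) (FOb G x)" "NMap s x \<in> homset D (FOb G x) (FOb F x)"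
    using s t x by (auto intro: nt_hom simp: homset_full_subcat)
  ultimately show ?thesis by (intro iso_arrI)
qed

lemma equivalence_surj:
  assumes "is_equivalence C D F" "y \<in> Obj D"
  obtains x m m' where "x \<in> Obj C" "m \<in> homset D (FOb F x) y" "m' \<in> homset D y (FOb F x)"
proof -
  obtain G where G: "is_functor D C G"
    "isomorphic_objs (functor_cat D D) (comp_functor D F G) (id_functor D)"
    using assms by (auto simp: is_equivalence_def)
  obtain t where t: "t \<in> homset (functor_cat D D) (comp_functor D F G) (id_functor D)"
    "iso_arr (functor_cat D D) t" using G by (auto simp: isomorphic_objs_def)
  obtain s where s: "s \<in> homset (functor_cat D D) (id_functor D) (comp_functor D F G)"
    using iso_arrE[OF t(2,1)] by metis
  show ?thesis
    using that[of "FOb G y" "NMap t y" "NMap s y"] nt_hom[OF t(1) assms(2)] nt_hom[OF s assms(2)]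
      assms(2) functor_ob[OF G(1)] by simp
qed

text \<open>Objects with equal images are isomorphic, because a quasi-inverse sends their common image to
  an object that is isomorphic to both.\<close>

lemma equivalence_inj:
  assumes "is_equivalence C D F" "x \<in> Obj C" "y \<in> Obj C" "FOb F x = FOb F y"
  obtains z s t where "s \<in> homset C z x" "iso_arr C s" "t \<in> homset C z y" "iso_arr C t"
proof -
  obtain G where G: "is_functor D C G"
    "isomorphic_objs (functor_cat C C) (comp_functor C G F) (id_functor C)"
    using assms by (auto simp: is_equivalence_def)
  obtain t where t: "t \<in> homset (functor_cat C C) (comp_functor C G F) (id_functor C)"
    "iso_arr (functor_cat C C) t" using G by (auto simp: isomorphic_objs_def)
  have t': "t \<in> homset (full_subcat (functor_cat C C) UNIV) (comp_functor C G F) (id_functor C)"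
    using t(1) by (simp add: homset_full_subcat)
  have i: "iso_arr (full_subcat (functor_cat C C) UNIV) t"
    using t(2) by (simp add: full_subcat_UNIV)
  have "NMap t v \<in> homset C (FOb G (FOb F v)) v \<and> iso_arr C (NMap t v)" if "v \<in> Obj C" for v
    using nt_hom[OF t(1) that] iso_nt_component[OF i t' that] that by simp
  then show ?thesis using that[of "NMap t x" "FOb G (FOb F x)" "NMap t y"] assms by metis
qed

section \<open>Left adjoints\<close>

lemma left_adjoint_functor: "left_adjoint C D F \<Longrightarrow> is_functor C D F"
  by (auto simp: left_adjoint_def adjunction_def)

lemma left_adjoint_id:
  assumes C: "category C"
  shows "left_adjoint C C (id_functor C)"
proof -
  let ?t = "Ide (functor_cat C C) (id_functor C)"
  have t: "?t \<in> homset (functor_cat C C) (id_functor C) (id_functor C)"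
    using C by (intro nt_Ide is_functor_id)
  have "Comp C (Ide C x) (Ide C x) = Ide C x" "Ide C x \<in> Arr C" if "x \<in> Obj C" for x
    using Comp_Ide(1)[OF C Ide_in[OF C that]] homsetD(1)[OF Ide_in[OF C that]] .
  then have "adjunction C C (id_functor C) (id_functor C) ?t ?t"
    using C t by (auto simp: adjunction_def is_functor_id comp_functor_id)
  then show ?thesis by (auto simp: left_adjoint_def)
qed

text \<open>The composite adjunction has components \<open>x \<rightarrow> G F x \<rightarrow> G G' F' F x\<close> of the unit and
  \<open>F' F G G' z \<rightarrow> F' G' z \<rightarrow> z\<close> of the counit. Each of its triangle identities reduces to those
  of the two factors by naturality of the inner transformation (\<open>\<epsilon>\<close> for the first identity,
  \<open>\<eta>'\<close> for the second).\<close>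

lemma left_adjoint_comp:
  assumes C: "category C" and D: "category D" and E: "category E"
    and "left_adjoint C D F" and "left_adjoint D E F'"
  shows "left_adjoint C E (comp_functor C F' F)"
proof -
  obtain G \<eta> \<epsilon> where "adjunction C D F G \<eta> \<epsilon>" using assms(4) by (auto simp: left_adjoint_def)
  then have F: "is_functor C D F" and G: "is_functor D C G"
    and \<eta>: "\<eta> \<in> homset (functor_cat C C) (id_functor C) (comp_functor C G F)"
    and \<epsilon>: "\<epsilon> \<in> homset (functor_cat D D) (comp_functor D F G) (id_functor D)"
    and tri1: "\<And>x. x \<in> Obj C \<Longrightarrow> Comp D (NMap \<epsilon> (FOb F x)) (FAr F (NMap \<eta> x)) = Ide D (FOb F x)"
    and tri2: "\<And>y. y \<in> Obj D \<Longrightarrow> Comp C (FAr G (NMap \<epsilon> y)) (NMap \<eta> (FOb G y)) = Ide C (FOb G y)"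
    by (auto simp: adjunction_def)
  obtain G' \<eta>' \<epsilon>' where "adjunction D E F' G' \<eta>' \<epsilon>'" using assms(5) by (auto simp: left_adjoint_def)
  then have F': "is_functor D E F'" and G': "is_functor E D G'"
    and \<eta>': "\<eta>' \<in> homset (functor_cat D D) (id_functor D) (comp_functor D G' F')"
    and \<epsilon>': "\<epsilon>' \<in> homset (functor_cat E E) (comp_functor E F' G') (id_functor E)"
    and tri1': "\<And>x. x \<in> Obj D \<Longrightarrow> Comp E (NMap \<epsilon>' (FOb F' x)) (FAr F' (NMap \<eta>' x)) = Ide E (FOb F' x)"
    and tri2': "\<And>y. y \<in> Obj E \<Longrightarrow> Comp D (FAr G' (NMap \<epsilon>' y)) (NMap \<eta>' (FOb G' y)) = Ide D (FOb G' y)"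
    by (auto simp: adjunction_def)
  note ob = functor_ob[OF F] functor_ob[OF F'] functor_ob[OF G] functor_ob[OF G']
  note hom = functor_hom[OF F] functor_hom[OF F'] functor_hom[OF G] functor_hom[OF G']
  let ?F = "comp_functor C F' F" and ?G = "comp_functor E G G'"
  have FF: "is_functor C E ?F" by (rule is_functor_comp[OF C F F'])
  have GG: "is_functor E C ?G" by (rule is_functor_comp[OF E G' G])
  have e: "NMap \<eta> x \<in> homset C x (FOb G (FOb F x))" if "x \<in> Obj C" for x
    using nt_hom[OF \<eta> that] that by simp
  have e': "NMap \<eta>' x \<in> homset D x (FOb G' (FOb F' x))" if "x \<in> Obj D" for x
    using nt_hom[OF \<eta>' that] that by simp
  have c: "NMap \<epsilon> x \<in> homset D (FOb F (FOb G x)) x" if "x \<in> Obj D" for x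
    using nt_hom[OF \<epsilon> that] that by simp
  have c': "NMap \<epsilon>' x \<in> homset E (FOb F' (FOb G' x)) x" if "x \<in> Obj E" for x
    using nt_hom[OF \<epsilon>' that] that by simp
  have en: "Comp C (NMap \<eta> y) f = Comp C (FAr G (FAr F f)) (NMap \<eta> x)" if "f \<in> homset C x y" for f x y
    using nt_natural[OF \<eta> that] homsetD(1)[OF that] by simp
  have e'n: "Comp D (NMap \<eta>' y) f = Comp D (FAr G' (FAr F' f)) (NMap \<eta>' x)" if "f \<in> homset D x y" for f x y
    using nt_natural[OF \<eta>' that] homsetD(1)[OF that] by simp
  have cn: "Comp D (NMap \<epsilon> y) (FAr F (FAr G f)) = Comp D f (NMap \<epsilon> x)" if "f \<in> homset D x y" for f x y
    using nt_natural[OF \<epsilon> that] homsetD(1)[OF that] by simp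
  have c'n: "Comp E (NMap \<epsilon>' y) (FAr F' (FAr G' f)) = Comp E f (NMap \<epsilon>' x)" if "f \<in> homset E x y" for f x y
    using nt_natural[OF \<epsilon>' that] homsetD(1)[OF that] by simp
  define u where "u = (\<lambda>x\<in>Obj C. Comp C (FAr G (NMap \<eta>' (FOb F x))) (NMap \<eta> x))"
  define v where "v = (\<lambda>z\<in>Obj E. Comp E (NMap \<epsilon>' z) (FAr F' (NMap \<epsilon> (FOb G' z))))"
  have Ge': "FAr G (NMap \<eta>' (FOb F x)) \<in> homset C (FOb G (FOb F x)) (FOb G (FOb G' (FOb F' (FOb F x))))"
    if "x \<in> Obj C" for x
    using that by (intro hom e' ob)
  have F'c: "FAr F' (NMap \<epsilon> (FOb G' z)) \<in> homset E (FOb F' (FOb F (FOb G (FOb G' z)))) (FOb F' (FOb G' z))"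
    if "z \<in> Obj E" for z
    using that by (intro hom c ob)
  have u: "u x \<in> homset C x (FOb G (FOb G' (FOb F' (FOb F x))))" if "x \<in> Obj C" for x
    using that Comp_in[OF C e Ge'] by (simp add: u_def)
  have v: "v z \<in> homset E (FOb F' (FOb F (FOb G (FOb G' z)))) z" if "z \<in> Obj E" for z
    using that Comp_in[OF E F'c c'] by (simp add: v_def)
  have un: "Comp C (u y) f = Comp C (FAr G (FAr G' (FAr F' (FAr F f)))) (u x)"
    if f: "f \<in> homset C x y" for f x y
  proof -
    have xy: "x \<in> Obj C" "y \<in> Obj C" using homset_obj[OF C f] .
    have Ff: "FAr F f \<in> homset D (FOb F x) (FOb F y)" by (rule functor_hom[OF F f])
    have GFf: "FAr G (FAr F f) \<in> homset C (FOb G (FOb F x)) (FOb G (FOb F y))" by (rule functor_hom[OF G Ff])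
    have H: "FAr G' (FAr F' (FAr F f)) \<in> homset D (FOb G' (FOb F' (FOb F x))) (FOb G' (FOb F' (FOb F y)))"
      by (intro functor_hom[OF G'] functor_hom[OF F'] Ff)
    have "Comp C (u y) f = Comp C (FAr G (NMap \<eta>' (FOb F y))) (Comp C (NMap \<eta> y) f)"
      using Comp_assoc[OF C f e Ge'] xy by (simp add: u_def)
    also have "\<dots> = Comp C (Comp C (FAr G (NMap \<eta>' (FOb F y))) (FAr G (FAr F f))) (NMap \<eta> x)"
      using Comp_assoc[OF C e GFf Ge'] xy en[OF f] by simp
    also have "Comp C (FAr G (NMap \<eta>' (FOb F y))) (FAr G (FAr F f))
        = FAr G (Comp D (NMap \<eta>' (FOb F y)) (FAr F f))"
      using functor_Comp[OF G Ff e'] xy by (simp add: ob)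
    also have "\<dots> = Comp C (FAr G (FAr G' (FAr F' (FAr F f)))) (FAr G (NMap \<eta>' (FOb F x)))"
      using functor_Comp[OF G e' H] e'n[OF Ff] xy by (simp add: ob)
    also have "Comp C \<dots> (NMap \<eta> x) = Comp C (FAr G (FAr G' (FAr F' (FAr F f)))) (u x)"
      using Comp_assoc[OF C e Ge' functor_hom[OF G H]] xy by (simp add: u_def)
    finally show ?thesis .
  qed
  have vn: "Comp E (v y) (FAr F' (FAr F (FAr G (FAr G' f)))) = Comp E f (v x)"
    if f: "f \<in> homset E x y" for f x y
  proof -
    have xy: "x \<in> Obj E" "y \<in> Obj E" using homset_obj[OF E f] .
    have G'f: "FAr G' f \<in> homset D (FOb G' x) (FOb G' y)" by (rule functor_hom[OF G' f])
    have F'G'f: "FAr F' (FAr G' f) \<in> homset E (FOb F' (FOb G' x)) (FOb F' (FOb G' y))"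
      by (rule functor_hom[OF F' G'f])
    have H: "FAr F (FAr G (FAr G' f)) \<in> homset D (FOb F (FOb G (FOb G' x))) (FOb F (FOb G (FOb G' y)))"
      by (intro functor_hom[OF G] functor_hom[OF F] G'f)
    have "Comp E (v y) (FAr F' (FAr F (FAr G (FAr G' f))))
        = Comp E (NMap \<epsilon>' y) (Comp E (FAr F' (NMap \<epsilon> (FOb G' y))) (FAr F' (FAr F (FAr G (FAr G' f)))))"
      using Comp_assoc[OF E functor_hom[OF F' H] F'c c'] xy by (simp add: v_def)
    also have "Comp E (FAr F' (NMap \<epsilon> (FOb G' y))) (FAr F' (FAr F (FAr G (FAr G' f))))
        = FAr F' (Comp D (NMap \<epsilon> (FOb G' y)) (FAr F (FAr G (FAr G' f))))"
      using functor_Comp[OF F' H c] xy by (simp add: ob)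
    also have "\<dots> = Comp E (FAr F' (FAr G' f)) (FAr F' (NMap \<epsilon> (FOb G' x)))"
      using functor_Comp[OF F' c G'f] cn[OF G'f] xy by (simp add: ob)
    also have "Comp E (NMap \<epsilon>' y) \<dots> = Comp E (Comp E (NMap \<epsilon>' y) (FAr F' (FAr G' f))) (FAr F' (NMap \<epsilon> (FOb G' x)))"
      using Comp_assoc[OF E F'c F'G'f c'] xy by simp
    also have "\<dots> = Comp E f (v x)"
      using Comp_assoc[OF E F'c c' f] c'n[OF f] xy by (simp add: v_def)
    finally show ?thesis .
  qed
  have t1: "Comp E (v (FOb F' (FOb F x))) (FAr F' (FAr F (u x))) = Ide E (FOb F' (FOb F x))"
    if x: "x \<in> Obj C" for x
  proof -
    let ?y = "FOb F x" and ?z = "FOb F' (FOb F x)"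
    have y: "?y \<in> Obj D" and z: "?z \<in> Obj E" using x by (auto intro: ob)
    have Fe: "FAr F (NMap \<eta> x) \<in> homset D ?y (FOb F (FOb G ?y))" by (intro hom e x)
    have FGe': "FAr F (FAr G (NMap \<eta>' ?y)) \<in> homset D (FOb F (FOb G ?y)) (FOb F (FOb G (FOb G' ?z)))"
      by (intro hom e' y)
    have G'z: "FOb G' ?z \<in> Obj D" by (intro ob z)
    have Fu: "FAr F (u x) \<in> homset D ?y (FOb F (FOb G (FOb G' ?z)))" by (intro hom u x)
    have "Comp D (NMap \<epsilon> (FOb G' ?z)) (FAr F (u x))
        = Comp D (NMap \<epsilon> (FOb G' ?z)) (Comp D (FAr F (FAr G (NMap \<eta>' ?y))) (FAr F (NMap \<eta> x)))"
      using functor_Comp[OF F e[OF x] Ge'[OF x]] x by (simp add: u_def)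
    also have "\<dots> = Comp D (Comp D (NMap \<eta>' ?y) (NMap \<epsilon> ?y)) (FAr F (NMap \<eta> x))"
      using Comp_assoc[OF D Fe FGe' c[OF G'z]] cn[OF e'[OF y]] by simp
    also have "\<dots> = NMap \<eta>' ?y"
      using Comp_assoc[OF D Fe c[OF y] e'[OF y]] tri1[OF x] Comp_Ide(1)[OF D e'[OF y]] by simp
    finally have *: "Comp D (NMap \<epsilon> (FOb G' ?z)) (FAr F (u x)) = NMap \<eta>' ?y" .
    have "Comp E (v ?z) (FAr F' (FAr F (u x)))
        = Comp E (NMap \<epsilon>' ?z) (Comp E (FAr F' (NMap \<epsilon> (FOb G' ?z))) (FAr F' (FAr F (u x))))"
      using Comp_assoc[OF E functor_hom[OF F' Fu] F'c[OF z] c'[OF z]] z by (simp add: v_def)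
    also have "\<dots> = Ide E ?z"
      using functor_Comp[OF F' Fu c[OF G'z]] * tri1'[OF y] by simp
    finally show ?thesis .
  qed
  have t2: "Comp C (FAr G (FAr G' (v z))) (u (FOb G (FOb G' z))) = Ide C (FOb G (FOb G' z))"
    if z: "z \<in> Obj E" for z
  proof -
    let ?y = "FOb G' z" and ?x = "FOb G (FOb G' z)"
    have y: "?y \<in> Obj D" and x: "?x \<in> Obj C" using z by (auto intro: ob)
    have G'c': "FAr G' (NMap \<epsilon>' z) \<in> homset D (FOb G' (FOb F' ?y)) ?y" by (intro hom c' z)
    have G'F'c: "FAr G' (FAr F' (NMap \<epsilon> ?y)) \<in> homset D (FOb G' (FOb F' (FOb F ?x))) (FOb G' (FOb F' ?y))"
      by (intro hom c y)
    have Fx: "FOb F ?x \<in> Obj D" by (intro ob x)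
    have G'v: "FAr G' (v z) \<in> homset D (FOb G' (FOb F' (FOb F ?x))) ?y" by (intro hom v z)
    have "Comp D (FAr G' (v z)) (NMap \<eta>' (FOb F ?x))
        = Comp D (Comp D (FAr G' (NMap \<epsilon>' z)) (FAr G' (FAr F' (NMap \<epsilon> ?y)))) (NMap \<eta>' (FOb F ?x))"
      using functor_Comp[OF G' F'c[OF z] c'[OF z]] z by (simp add: v_def)
    also have "\<dots> = Comp D (FAr G' (NMap \<epsilon>' z)) (Comp D (NMap \<eta>' ?y) (NMap \<epsilon> ?y))"
      using Comp_assoc[OF D e'[OF Fx] G'F'c G'c'] e'n[OF c[OF y]] by simp
    also have "\<dots> = NMap \<epsilon> ?y"
      using Comp_assoc[OF D c[OF y] e'[OF y] G'c'] tri2'[OF z] Comp_Ide(2)[OF D c[OF y]] by simp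
    finally have *: "Comp D (FAr G' (v z)) (NMap \<eta>' (FOb F ?x)) = NMap \<epsilon> ?y" .
    have "Comp C (FAr G (FAr G' (v z))) (u ?x)
        = Comp C (Comp C (FAr G (FAr G' (v z))) (FAr G (NMap \<eta>' (FOb F ?x)))) (NMap \<eta> ?x)"
      using Comp_assoc[OF C e[OF x] Ge'[OF x] functor_hom[OF G G'v]] x by (simp add: u_def)
    also have "\<dots> = Ide C ?x"
      using functor_Comp[OF G e'[OF Fx] G'v] * tri2[OF y] by simp
    finally show ?thesis .
  qed
  have "\<lparr>NDom = id_functor C, NCod = comp_functor C ?G ?F, NMap = u\<rparr>
      \<in> homset (functor_cat C C) (id_functor C) (comp_functor C ?G ?F)"
    using u un[OF homsetI[OF _ refl refl]] homsetD(1)[OF functor_hom[OF FF homsetI[OF _ refl refl]]]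
    by (intro nt_homI is_functor_id is_functor_comp[OF C FF GG] C) (auto simp: u_def ob)
  moreover have "\<lparr>NDom = comp_functor E ?F ?G, NCod = id_functor E, NMap = v\<rparr>
      \<in> homset (functor_cat E E) (comp_functor E ?F ?G) (id_functor E)"
    using v vn[OF homsetI[OF _ refl refl]] homsetD(1)[OF functor_hom[OF GG homsetI[OF _ refl refl]]]
    by (intro nt_homI is_functor_id is_functor_comp[OF E GG FF] E) (auto simp: v_def ob)
  moreover have "u x \<in> Arr C" if "x \<in> Obj C" for x using u[OF that] by (rule homsetD)
  moreover have "v x \<in> Arr E" if "x \<in> Obj E" for x using v[OF that] by (rule homsetD)
  ultimately have "adjunction C E ?F ?G \<lparr>NDom = id_functor C, NCod = comp_functor C ?G ?F, NMap = u\<rparr>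
      \<lparr>NDom = comp_functor E ?F ?G, NCod = id_functor E, NMap = v\<rparr>"
    using FF GG t1 t2 by (auto simp: adjunction_def ob)
  then show ?thesis unfolding left_adjoint_def by blast
qed

section \<open>Weak factorization systems and model categories\<close>

lemma has_liftingD:
  assumes "has_lifting C l r" "u \<in> homset C (Dom C l) (Dom C r)" "v \<in> homset C (Cod C l) (Cod C r)"
    "Comp C r u = Comp C v l"
  obtains h where "h \<in> homset C (Cod C l) (Dom C r)" "Comp C h l = u" "Comp C r h = v"
  using assms unfolding has_lifting_def by blast

lemma iso_lifts_left:
  assumes C: "category C" and l: "iso_arr C l" and r: "r \<in> Arr C"
  shows "has_lifting C l r"
  unfolding has_lifting_def
proof (intro ballI impI)
  fix u v assume u: "u \<in> homset C (Dom C l) (Dom C r)" and v: "v \<in> homset C (Cod C l) (Cod C r)"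
    and sq: "Comp C r u = Comp C v l"
  have lh: "l \<in> homset C (Dom C l) (Cod C l)" and rh: "r \<in> homset C (Dom C r) (Cod C r)"
    using l r by (auto simp: homset_def iso_arr_def)
  obtain k where k: "k \<in> homset C (Cod C l) (Dom C l)"
    "Comp C k l = Ide C (Dom C l)" "Comp C l k = Ide C (Cod C l)"
    using l lh by (rule iso_arrE)
  have "Comp C (Comp C u k) l = u"
    using Comp_assoc[OF C lh k(1) u] k Comp_Ide[OF C u] by simp
  moreover have "Comp C r (Comp C u k) = v"
    using Comp_assoc[OF C k(1) u rh] sq Comp_assoc[OF C k(1) lh v] k Comp_Ide[OF C v] by simp
  ultimately show "\<exists>h\<in>homset C (Cod C l) (Dom C r). Comp C h l = u \<and> Comp C r h = v"
    using Comp_in[OF C k(1) u] by blast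
qed

lemma iso_lifts_right:
  assumes C: "category C" and r: "iso_arr C r" and l: "l \<in> Arr C"
  shows "has_lifting C l r"
  unfolding has_lifting_def
proof (intro ballI impI)
  fix u v assume u: "u \<in> homset C (Dom C l) (Dom C r)" and v: "v \<in> homset C (Cod C l) (Cod C r)"
    and sq: "Comp C r u = Comp C v l"
  have lh: "l \<in> homset C (Dom C l) (Cod C l)" and rh: "r \<in> homset C (Dom C r) (Cod C r)"
    using l r by (auto simp: homset_def iso_arr_def)
  obtain k where k: "k \<in> homset C (Cod C r) (Dom C r)"
    "Comp C k r = Ide C (Dom C r)" "Comp C r k = Ide C (Cod C r)"
    using r rh by (rule iso_arrE)
  have "Comp C (Comp C k v) l = u"
    using Comp_assoc[OF C lh v k(1)] sq Comp_assoc[OF C u rh k(1)] k Comp_Ide[OF C u] by simp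
  moreover have "Comp C r (Comp C k v) = v"
    using Comp_assoc[OF C v k(1) rh] k Comp_Ide[OF C v] by simp
  ultimately show "\<exists>h\<in>homset C (Cod C l) (Dom C r). Comp C h l = u \<and> Comp C r h = v"
    using Comp_in[OF C v k(1)] by blast
qed

text \<open>A solution of the square with identity sides is an inverse.\<close>

lemma iso_if_lifts_self:
  assumes C: "category C" and f: "f \<in> Arr C" and "has_lifting C f f"
  shows "iso_arr C f"
proof -
  have fh: "f \<in> homset C (Dom C f) (Cod C f)" using f by (simp add: homset_def)
  obtain h where "h \<in> homset C (Cod C f) (Dom C f)" "Comp C h f = Ide C (Dom C f)"
    "Comp C f h = Ide C (Cod C f)"
    using has_liftingD[OF assms(3) Ide_in[OF C Dom_obj[OF C f]] Ide_in[OF C Cod_obj[OF C f]]]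
      Comp_Ide[OF C fh] by auto
  then show ?thesis using iso_arrI[OF fh] by blast
qed

lemma llp_Comp:
  assumes C: "category C" and R: "R \<subseteq> Arr C" and f: "f \<in> llp C R" and g: "g \<in> llp C R"
    and fg: "Cod C f = Dom C g"
  shows "Comp C g f \<in> llp C R"
proof -
  have fh: "f \<in> homset C (Dom C f) (Dom C g)" and gh: "g \<in> homset C (Dom C g) (Cod C g)"
    using f g fg by (auto simp: llp_def homset_def)
  note gf = homsetD[OF Comp_in[OF C fh gh]]
  have "has_lifting C (Comp C g f) r" if r: "r \<in> R" for r
    unfolding has_lifting_def gf
  proof (intro ballI impI)
    fix u v assume u: "u \<in> homset C (Dom C f) (Dom C r)" and v: "v \<in> homset C (Cod C g) (Cod C r)"
      and sq: "Comp C r u = Comp C v (Comp C g f)"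
    have "Comp C r u = Comp C (Comp C v g) f" using sq Comp_assoc[OF C fh gh v] by simp
    then obtain h where h: "h \<in> homset C (Dom C g) (Dom C r)" "Comp C h f = u" "Comp C r h = Comp C v g"
      using has_liftingD[of C f r u "Comp C v g"] f r u Comp_in[OF C gh v] fg
      by (auto simp: llp_def)
    obtain k where k: "k \<in> homset C (Cod C g) (Dom C r)" "Comp C k g = h" "Comp C r k = v"
      using has_liftingD[of C g r h v] g r h v by (auto simp: llp_def)
    have "Comp C k (Comp C g f) = u" using Comp_assoc[OF C fh gh k(1)] h k by simp
    then show "\<exists>h\<in>homset C (Cod C g) (Dom C r). Comp C h (Comp C g f) = u \<and> Comp C r h = v"
      using k by blast
  qed
  then show ?thesis using gf by (simp add: llp_def)
qed

lemma wfs_iso_all: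
  assumes C: "category C"
  shows "weak_factorization_system C {f. iso_arr C f} (Arr C)"
  unfolding weak_factorization_system_def
proof (intro conjI ballI)
  show "{f. iso_arr C f} = llp C (Arr C)"
    using iso_lifts_left[OF C] iso_if_lifts_self[OF C] by (auto simp: llp_def iso_arr_def[of C])
  show "Arr C = rlp C {f. iso_arr C f}"
    using iso_lifts_left[OF C] by (auto simp: rlp_def)
  fix f assume f: "f \<in> Arr C"
  then have fh: "f \<in> homset C (Dom C f) (Cod C f)" by (simp add: homset_def)
  show "\<exists>l\<in>{f. iso_arr C f}. \<exists>r\<in>Arr C. Cod C l = Dom C r \<and> f = Comp C r l"
    using iso_Ide[OF C Dom_obj[OF C f]] homsetD[OF Ide_in[OF C Dom_obj[OF C f]]] f Comp_Ide[OF C fh]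
    by (intro bexI[of _ "Ide C (Dom C f)"] bexI[of _ f]) auto
qed

lemma model_category_category: "model_category C S \<Longrightarrow> category C"
  by (simp add: model_category_def)

lemma model_lp:
  assumes "model_category C S"
  shows "Cof S = llp C (Afib S)" "Afib S = rlp C (Cof S)" "Acof S = llp C (Fib S)" "Fib S = rlp C (Acof S)"
  using assms unfolding model_category_def weak_factorization_system_def by blast+

lemma model_sub:
  assumes "model_category C S"
  shows "Cof S \<subseteq> Arr C" "Fib S \<subseteq> Arr C" "Weq S \<subseteq> Arr C"
proof -
  show "Cof S \<subseteq> Arr C" by (subst model_lp(1)[OF assms]) (auto simp: llp_def)
  show "Fib S \<subseteq> Arr C" by (subst model_lp(4)[OF assms]) (auto simp: rlp_def)
  show "Weq S \<subseteq> Arr C" using assms by (simp add: model_category_def)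
qed

lemma model_iso:
  assumes "model_category C S" "iso_arr C f"
  shows "f \<in> Cof S" "f \<in> Fib S" "f \<in> Weq S"
proof -
  have C: "category C" using assms(1) by (rule model_category_category)
  have f: "f \<in> Arr C" using assms(2) by (simp add: iso_arr_def)
  have A: "f \<in> Acof S" unfolding model_lp(3)[OF assms(1)] llp_def
    using f iso_lifts_left[OF C assms(2)] model_sub[OF assms(1)] by auto
  show "f \<in> Cof S" "f \<in> Weq S" using A by (auto simp: Acof_def)
  show "f \<in> Fib S" unfolding model_lp(4)[OF assms(1)] rlp_def
    using f iso_lifts_right[OF C assms(2)] model_sub[OF assms(1)] by (auto simp: Acof_def)
qed

lemma model_two_of_three:
  assumes "model_category C S" "f \<in> homset C x y" "g \<in> homset C y z"
  shows "f \<in> Weq S \<Longrightarrow> g \<in> Weq S \<Longrightarrow> Comp C g f \<in> Weq S"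
    "f \<in> Weq S \<Longrightarrow> Comp C g f \<in> Weq S \<Longrightarrow> g \<in> Weq S"
    "g \<in> Weq S \<Longrightarrow> Comp C g f \<in> Weq S \<Longrightarrow> f \<in> Weq S"
  using assms by (auto simp: model_category_def two_out_of_three_def homset_def)

lemma model_factor_Cof_Afib:
  assumes "model_category C S" "f \<in> homset C x y"
  obtains l r z where "l \<in> Cof S" "r \<in> Afib S" "l \<in> homset C x z" "r \<in> homset C z y" "f = Comp C r l"
proof -
  have C: "category C" using assms(1) by (rule model_category_category)
  obtain l r where lr: "l \<in> Cof S" "r \<in> Afib S" "Cod C l = Dom C r" "f = Comp C r l"
    using assms unfolding model_category_def weak_factorization_system_def homset_def by blast
  have l: "l \<in> homset C (Dom C l) (Dom C r)" and r: "r \<in> homset C (Dom C r) (Cod C r)"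
    using lr model_sub[OF assms(1)] by (auto simp: homset_def Afib_def)
  have "Dom C l = x" "Cod C r = y"
    using Comp_in[OF C l r] lr(4) assms(2) by (simp_all add: homset_def)
  then show ?thesis using that[OF lr(1,2)] l r lr(4) by auto
qed

lemma model_factor_Acof_Fib:
  assumes "model_category C S" "f \<in> homset C x y"
  obtains l r z where "l \<in> Acof S" "r \<in> Fib S" "l \<in> homset C x z" "r \<in> homset C z y" "f = Comp C r l"
proof -
  have C: "category C" using assms(1) by (rule model_category_category)
  obtain l r where lr: "l \<in> Acof S" "r \<in> Fib S" "Cod C l = Dom C r" "f = Comp C r l"
    using assms unfolding model_category_def weak_factorization_system_def homset_def by blast
  have l: "l \<in> homset C (Dom C l) (Dom C r)" and r: "r \<in> homset C (Dom C r) (Cod C r)"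
    using lr model_sub[OF assms(1)] by (auto simp: homset_def Acof_def)
  have "Dom C l = x" "Cod C r = y"
    using Comp_in[OF C l r] lr(4) assms(2) by (simp_all add: homset_def)
  then show ?thesis using that[OF lr(1,2)] l r lr(4) by auto
qed

text \<open>By two-out-of-three, the weak equivalences are the composites of an acyclic cofibration and an
  acyclic fibration. So a model structure is determined by its cofibrations and acyclic cofibrations,
  which makes the order on model structures antisymmetric.\<close>

lemma model_Weq_mono:
  assumes S: "model_category C S" and T: "model_category C T"
    and "Acof S \<subseteq> Acof T" "Afib S \<subseteq> Afib T"
  shows "Weq S \<subseteq> Weq T"
proof
  fix f assume f: "f \<in> Weq S"
  then have "f \<in> homset C (Dom C f) (Cod C f)" using model_sub(3)[OF S] by (auto simp: homset_def)
  then obtain l r z where lr: "l \<in> Acof S" "r \<in> Fib S" "l \<in> homset C (Dom C f) z"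
    "r \<in> homset C z (Cod C f)" "f = Comp C r l"
    by (rule model_factor_Acof_Fib[OF S])
  have "r \<in> Weq S" using model_two_of_three(2)[OF S lr(3,4)] lr f by (auto simp: Acof_def)
  then have "r \<in> Weq T" "l \<in> Weq T" using lr assms(3,4) by (auto simp: Afib_def Acof_def)
  then show "f \<in> Weq T" using model_two_of_three(1)[OF T lr(3,4)] lr(5) by simp
qed

lemma model_structure_eqI:
  fixes S T :: "'u mstruct"
  assumes S: "model_category C S" and T: "model_category C T"
    and "Cof S = Cof T" "Acof S = Acof T"
  shows "S = T"
proof -
  have "Afib S = Afib T" "Fib S = Fib T"
    using model_lp(2,4)[OF S] model_lp(2,4)[OF T] assms(3,4) by simp_all
  moreover from this have "Weq S = Weq T"
    using model_Weq_mono[OF S T] model_Weq_mono[OF T S] assms(4) by blast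
  ultimately show ?thesis using assms(3) by simp
qed

lemma model_structure_partial_order: "Order.partial_order (model_structure_poset C)"
proof -
  have "S = T" if "model_category C S" "model_category C T" "Cof S \<subseteq> Cof T" "Acof S \<subseteq> Acof T"
    "Cof T \<subseteq> Cof S" "Acof T \<subseteq> Acof S" for S T
    using that by (intro model_structure_eqI[of C]) auto
  then show ?thesis
    by (auto simp: Order.partial_order_def Order.partial_order_axioms_def
        Order.weak_partial_order_def Order.weak_partial_order_axioms_def equivalence_def
        model_structure_poset_def)
qed

text \<open>Every left adjoint out of a category with this structure is left Quillen, so it tests a
  bilimit of model categories for the underlying categories alone.\<close>

definition least_structure :: "('u, 'u) cat \<Rightarrow> 'u mstruct" where
  "least_structure C = \<lparr>Weq = Arr C, Cof = {f. iso_arr C f}, Fib = Arr C\<rparr>"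

lemma two_out_of_three_all: "category C \<Longrightarrow> two_out_of_three C (Arr C)"
  by (auto simp: two_out_of_three_def category_def homset_def)

lemma least_structure_classes:
  "Cof (least_structure C) = {f. iso_arr C f}" "Acof (least_structure C) = {f. iso_arr C f}"
  "Fib (least_structure C) = Arr C" "Afib (least_structure C) = Arr C"
  by (auto simp: least_structure_def Acof_def Afib_def iso_arr_def)

lemma least_structure_combinatorial:
  assumes "locally_presentable C" "complete_cat C"
  shows "combinatorial_model_category C (least_structure C)"
proof -
  have C: "category C" "cocomplete_cat C" using assms(1) by (auto simp: locally_presentable_def)
  have "model_category C (least_structure C)"
    using C assms(2) wfs_iso_all[OF C(1)] two_out_of_three_all[OF C(1)]
    by (simp add: model_category_def least_structure_classes) (simp add: least_structure_def)
  moreover have "small {}" by (auto simp: small_def lesspoll_def lepoll_def eqpoll_def bij_betw_def)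
  then have "\<exists>I\<subseteq>Arr C. small I \<and> Arr C = rlp C I"
    by (intro exI[of _ "{}"]) (simp add: rlp_def)
  ultimately show ?thesis using assms(1)
    by (simp add: combinatorial_model_category_def least_structure_classes)
qed

lemma left_quillen_from_least:
  assumes "model_category D T" "left_adjoint C D F" "category C"
  shows "left_quillen (C, least_structure C) (D, T) F"
proof -
  have "iso_arr D (FAr F f)" if "iso_arr C f" for f
    using functor_iso[OF assms(3) left_adjoint_functor[OF assms(2)] _ that] that
    by (auto simp: homset_def iso_arr_def[of C])
  then show ?thesis using model_iso[OF assms(1)] assms(2)
    by (auto simp: left_quillen_def least_structure_classes Acof_def)
qed

lemma left_quillen_id:
  assumes "category C" "Cof S \<subseteq> Arr C" "Cof S \<subseteq> Cof T" "Acof S \<subseteq> Acof T"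
  shows "left_quillen (C, S) (C, T) (id_functor C)"
proof -
  have "FAr (id_functor C) f = f" if "f \<in> Cof S" for f using that assms(2) by auto
  moreover have "Acof S \<subseteq> Cof S" by (auto simp: Acof_def)
  ultimately show ?thesis using assms left_adjoint_id[OF assms(1)]
    by (auto simp: left_quillen_def subset_iff)
qed

section \<open>Finite posets as categories\<close>

lemma small_finite: "infinite (UNIV :: 'u set) \<Longrightarrow> finite (A :: 'u set) \<Longrightarrow> small A"
  by (simp add: small_def finite_lesspoll_infinite)

text \<open>The cardinal is \<open>\<aleph>\<^sub>0\<close>, placed on a countably infinite subset of the universe.\<close>

lemma ex_small_regular_cardinal:
  assumes "uncountable (UNIV :: 'u set)"
  shows "\<exists>l :: 'u rel. small_regular_cardinal l"
proof -
  have "infinite (UNIV :: 'u set)" using assms countable_finite by blast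
  then obtain e :: "nat \<Rightarrow> 'u" where e: "inj e" using infinite_countable_subset by blast
  have "bij_betw e UNIV (range e)" using e by (simp add: bij_betw_def)
  then have "(card_of (UNIV :: nat set), card_of (range e)) \<in> ordIso" by (rule card_of_ordIsoI)
  then have "(natLeq, card_of (range e)) \<in> ordIso"
    using ordIso_transitive[OF ordIso_symmetric[OF card_of_nat]] by blast
  then have "regularCard (card_of (range e))"
    using regularCard_ordIso[OF _ natLeq_Cinfinite regularCard_natLeq] by blast
  moreover have "small (range e)"
  proof -
    have "\<not> range e \<approx> (UNIV :: 'u set)"
      using assms by (meson countableI_type countable_image countable_eqpoll eqpoll_sym)
    moreover have "range e \<lesssim> (UNIV :: 'u set)" by (simp add: subset_imp_lepoll)
    ultimately show ?thesis by (simp add: small_def lesspoll_def)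
  qed
  moreover have "infinite (range e)" using e finite_imageD by blast
  ultimately have "small_regular_cardinal (card_of (range e))"
    by (simp add: small_regular_cardinal_def Field_card_of card_of_card_order_on)
  then show ?thesis by blast
qed

lemma category_set_cat: "category set_cat"
  by (auto simp: category_def set_cat_def homset_def compose_def restrict_def PiE_def Pi_def
      extensional_def)

lemma is_functor_hom_functor:
  assumes C: "category C" and "locally_small C" and k: "k \<in> Obj C"
  shows "is_functor C set_cat (hom_functor C k)"
  unfolding is_functor_def
proof (intro conjI ballI impI)
  have sm: "small (homset C k x)" if "x \<in> Obj C" for x
    using assms(2) k that by (simp add: locally_small_def)
  show "FOb (hom_functor C k) \<in> Obj C \<rightarrow>\<^sub>E Obj set_cat"
    using sm by (auto simp: hom_functor_def set_cat_def)
  have h: "FAr (hom_functor C k) f \<in> homset set_cat (homset C k x) (homset C k y)"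
    if f: "f \<in> homset C x y" for f x y
    using f homset_obj[OF C f] sm Comp_in[OF C _ f]
    by (intro homsetI) (auto simp: hom_functor_def set_cat_def homsetD[OF f])
  show "FAr (hom_functor C k) \<in> Arr C \<rightarrow>\<^sub>E Arr set_cat"
    using homsetD(1)[OF h[OF homsetI[OF _ refl refl]]] by (auto simp: hom_functor_def)
  show "FAr (hom_functor C k) f
      \<in> homset set_cat (FOb (hom_functor C k) (Dom C f)) (FOb (hom_functor C k) (Cod C f))"
    if "f \<in> Arr C" for f
    using h[OF homsetI[OF that refl refl]] Dom_obj[OF C that] Cod_obj[OF C that]
    by (simp add: hom_functor_def)
  show "FAr (hom_functor C k) (Ide C x) = Ide set_cat (FOb (hom_functor C k) x)" if "x \<in> Obj C" for x
    using that homsetD[OF Ide_in[OF C that]] Comp_Ide(2)[OF C]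
    by (auto simp: hom_functor_def set_cat_def)
  show "FAr (hom_functor C k) (Comp C g f)
      = Comp set_cat (FAr (hom_functor C k) g) (FAr (hom_functor C k) f)"
    if "f \<in> Arr C" "g \<in> Arr C" "Cod C f = Dom C g" for f g
  proof -
    have f: "f \<in> homset C (Dom C f) (Dom C g)" and g: "g \<in> homset C (Dom C g) (Cod C g)"
      using that by (auto simp: homset_def)
    show ?thesis
      using that homsetD[OF Comp_in[OF C f g]] Comp_assoc[OF C _ f g] Comp_in[OF C _ f]
      by (auto simp: hom_functor_def set_cat_def compose_def fun_eq_iff)
  qed
qed

lemma poset_cat_simps [simp]:
  "Obj (poset_cat A r) = A" "Arr (poset_cat A r) = r" "Dom (poset_cat A r) = fst"
  "Cod (poset_cat A r) = snd" "Ide (poset_cat A r) = (\<lambda>x. (x, x))"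
  "Comp (poset_cat A r) = (\<lambda>g f. (fst f, snd g))"
  by (simp_all add: poset_cat_def)

lemma directed_poset_bound:
  assumes "directed_poset l A r" "infinite (Field l)" "B \<subseteq> A" "finite B"
  shows "\<exists>x\<in>A. \<forall>y\<in>B. (y, x) \<in> r"
  using assms finite_lesspoll_infinite[of "Field l" B] by (simp add: directed_poset_def)

locale finite_poset_category =
  fixes M :: "('o, 'm) cat"
  assumes category: "category M"
    and finite_Obj: "finite (Obj M)"
    and thin: "f \<in> homset M x y \<Longrightarrow> g \<in> homset M x y \<Longrightarrow> f = g"
    and skeletal: "f \<in> homset M x y \<Longrightarrow> g \<in> homset M y x \<Longrightarrow> x = y"
begin

definition below :: "'o \<Rightarrow> 'o \<Rightarrow> bool" where
  "below x y \<longleftrightarrow> homset M x y \<noteq> {}"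

lemma below_trans: "below x y \<Longrightarrow> below y z \<Longrightarrow> below x z"
  using Comp_in[OF category] by (fastforce simp: below_def)

lemma finite_homset: "finite (homset M x y)"
proof (cases "homset M x y = {}")
  case False
  then obtain f where "f \<in> homset M x y" by blast
  then have "homset M x y \<subseteq> {f}" using thin by blast
  then show ?thesis by (rule finite_subset) simp
qed simp

lemma finite_Arr: "finite (Arr M)"
proof -
  have "Arr M \<subseteq> (\<Union>x\<in>Obj M. \<Union>y\<in>Obj M. homset M x y)"
    using Dom_obj[OF category] Cod_obj[OF category] by (auto simp: homset_def)
  moreover have "finite (\<Union>x\<in>Obj M. \<Union>y\<in>Obj M. homset M x y)"
    using finite_Obj finite_homset by blast
  ultimately show ?thesis by (rule finite_subset)
qed

lemma arr_eqI: "f \<in> Arr M \<Longrightarrow> g \<in> Arr M \<Longrightarrow> Dom M f = Dom M g \<Longrightarrow> Cod M f = Cod M g \<Longrightarrow> f = g"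
  using thin by (auto simp: homset_def)

lemma functor_eq:
  fixes F G :: "('p, 'n, 'o, 'm) func"
  assumes F: "is_functor C M F" and G: "is_functor C M G" and C: "category C"
    and eq: "\<And>x. x \<in> Obj C \<Longrightarrow> FOb F x = FOb G x"
  shows "F = G"
proof (rule functor_eqI[OF F G eq])
  fix f assume f: "f \<in> Arr C"
  then have "f \<in> homset C (Dom C f) (Cod C f)" by (simp add: homset_def)
  from functor_hom[OF F this] functor_hom[OF G this] show "FAr F f = FAr G f"
    using eq Dom_obj[OF C f] Cod_obj[OF C f] by (auto intro: thin)
qed

lemma nt_eq:
  fixes s t :: "('p, 'n, 'o, 'm) nt"
  assumes "s \<in> homset (functor_cat C M) F G" "t \<in> homset (functor_cat C M) F G"
  shows "s = t"
proof -
  have "NMap s = NMap t"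
  proof (rule extensionalityI)
    show "NMap s \<in> extensional (Obj C)" "NMap t \<in> extensional (Obj C)"
      using assms by (auto simp: homset_def nat_trans_def)
    show "NMap s x = NMap t x" if "x \<in> Obj C" for x
      using nt_hom[OF assms(1) that] nt_hom[OF assms(2) that] by (rule thin)
  qed
  moreover have "NDom s = NDom t" "NCod s = NCod t" using assms by (auto simp: homset_def)
  ultimately show ?thesis by simp
qed

lemma functors_eq_if_nts:
  assumes "s \<in> homset (functor_cat C M) F G" "t \<in> homset (functor_cat C M) G F" "category C"
  shows "F = G"
  using nt_functors[OF assms(1)] nt_hom[OF assms(1)] nt_hom[OF assms(2)] assms(3)
  by (intro functor_eq) (auto intro: skeletal)

lemma iso_iff_Ide: "iso_arr M f \<longleftrightarrow> f \<in> Ide M ` Obj M"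
proof
  assume f: "iso_arr M f"
  then have fh: "f \<in> homset M (Dom M f) (Cod M f)" by (simp add: iso_arr_def homset_def)
  then obtain g where "g \<in> homset M (Cod M f) (Dom M f)" using f by (blast elim: iso_arrE)
  then have "Dom M f = Cod M f" using fh skeletal by blast
  then have "f = Ide M (Dom M f)" using thin fh Ide_in[OF category homset_obj(1)[OF category fh]] by simp
  then show "f \<in> Ide M ` Obj M" using homset_obj(1)[OF category fh] by blast
qed (auto intro: iso_Ide category)

lemma has_lifting_iff:
  assumes "l \<in> Arr M" "r \<in> Arr M"
  shows "has_lifting M l r \<longleftrightarrow>
    (below (Dom M l) (Dom M r) \<and> below (Cod M l) (Cod M r) \<longrightarrow> below (Cod M l) (Dom M r))"
proof -
  have lh: "l \<in> homset M (Dom M l) (Cod M l)" and rh: "r \<in> homset M (Dom M r) (Cod M r)"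
    using assms by (auto simp: homset_def)
  have "Comp M r u = Comp M v l"
    if "u \<in> homset M (Dom M l) (Dom M r)" "v \<in> homset M (Cod M l) (Cod M r)" for u v
    using thin[OF Comp_in[OF category that(1) rh] Comp_in[OF category lh that(2)]] .
  moreover have "Comp M h l = u" if "u \<in> homset M (Dom M l) (Dom M r)" "h \<in> homset M (Cod M l) (Dom M r)" for u h
    using thin[OF Comp_in[OF category lh that(2)] that(1)] .
  moreover have "Comp M r h = v" if "v \<in> homset M (Cod M l) (Cod M r)" "h \<in> homset M (Cod M l) (Dom M r)" for v h
    using thin[OF Comp_in[OF category that(2) rh] that(1)] .
  ultimately show ?thesis unfolding has_lifting_def below_def by blast
qed

end

locale finite_lattice_category = finite_poset_category M for M :: "('u, 'u) cat" +
  assumes meet: "X \<subseteq> Obj M \<Longrightarrow> \<exists>m\<in>Obj M. (\<forall>x\<in>X. below m x) \<and> (\<forall>y\<in>Obj M. (\<forall>x\<in>X. below y x) \<longrightarrow> below y m)"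
    and join: "X \<subseteq> Obj M \<Longrightarrow> \<exists>m\<in>Obj M. (\<forall>x\<in>X. below x m) \<and> (\<forall>y\<in>Obj M. (\<forall>x\<in>X. below x y) \<longrightarrow> below m y)"
    and universe: "uncountable (UNIV :: 'u set)"
begin

lemma infinite_universe: "infinite (UNIV :: 'u set)"
  using universe countable_finite by blast

lemma complete: "complete_cat M"
  unfolding complete_cat_def
proof (intro allI impI, elim conjE)
  fix J :: "('u, 'u) cat" and D
  assume "small_category J" and D: "is_functor J M D"
  then have J: "category J" by (simp add: small_category_def)
  have "FOb D ` Obj J \<subseteq> Obj M" using functor_ob[OF D] by blast
  from meet[OF this] obtain m where "m \<in> Obj M" "\<forall>x\<in>FOb D ` Obj J. below m x"
    "\<forall>y\<in>Obj M. (\<forall>x\<in>FOb D ` Obj J. below y x) \<longrightarrow> below y m" by (elim bexE conjE)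
  then have m: "m \<in> Obj M" "\<And>j. j \<in> Obj J \<Longrightarrow> below m (FOb D j)"
    "\<And>y. y \<in> Obj M \<Longrightarrow> (\<And>j. j \<in> Obj J \<Longrightarrow> below y (FOb D j)) \<Longrightarrow> below y m" by simp_all
  define p where "p j = (SOME f. f \<in> homset M m (FOb D j))" for j
  have p: "p j \<in> homset M m (FOb D j)" if "j \<in> Obj J" for j
    unfolding p_def using m(2)[OF that] by (auto simp: below_def intro: someI)
  have "is_cone M J D m p"
    unfolding is_cone_def
  proof (intro conjI ballI)
    fix u assume u: "u \<in> Arr J"
    have "Comp M (FAr D u) (p (Dom J u)) \<in> homset M m (FOb D (Cod J u))"
      using Comp_in[OF category p functor_hom[OF D homsetI[OF u refl refl]]] Dom_obj[OF J u] by blast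
    then show "Comp M (FAr D u) (p (Dom J u)) = p (Cod J u)"
      using p[OF Cod_obj[OF J u]] by (rule thin)
  qed (use m p in auto)
  moreover have "\<exists>!h. h \<in> homset M y m \<and> (\<forall>j\<in>Obj J. Comp M (p j) h = q j)"
    if q: "is_cone M J D y q" for y q
  proof -
    have q': "q j \<in> homset M y (FOb D j)" if "j \<in> Obj J" for j using q that by (simp add: is_cone_def)
    have "y \<in> Obj M" using q by (simp add: is_cone_def)
    then have "below y m" using q' by (intro m(3)) (auto simp: below_def)
    then obtain h where h: "h \<in> homset M y m" by (auto simp: below_def)
    have "Comp M (p j) h = q j" if "j \<in> Obj J" for j
      using thin[OF Comp_in[OF category h p[OF that]] q'[OF that]] .
    then show ?thesis using h by (intro ex1I[of _ h] conjI ballI) (auto intro: thin)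
  qed
  ultimately have "is_limit M J D m p" by (simp add: is_limit_def)
  then show "\<exists>x p. is_limit M J D x p" by blast
qed

lemma cocomplete: "cocomplete_cat M"
  unfolding cocomplete_cat_def
proof (intro allI impI, elim conjE)
  fix J :: "('u, 'u) cat" and D
  assume "small_category J" and D: "is_functor J M D"
  then have J: "category J" by (simp add: small_category_def)
  have "FOb D ` Obj J \<subseteq> Obj M" using functor_ob[OF D] by blast
  from join[OF this] obtain m where "m \<in> Obj M" "\<forall>x\<in>FOb D ` Obj J. below x m"
    "\<forall>y\<in>Obj M. (\<forall>x\<in>FOb D ` Obj J. below x y) \<longrightarrow> below m y" by (elim bexE conjE)
  then have m: "m \<in> Obj M" "\<And>j. j \<in> Obj J \<Longrightarrow> below (FOb D j) m"
    "\<And>y. y \<in> Obj M \<Longrightarrow> (\<And>j. j \<in> Obj J \<Longrightarrow> below (FOb D j) y) \<Longrightarrow> below m y" by simp_all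
  define p where "p j = (SOME f. f \<in> homset M (FOb D j) m)" for j
  have p: "p j \<in> homset M (FOb D j) m" if "j \<in> Obj J" for j
    unfolding p_def using m(2)[OF that] by (auto simp: below_def intro: someI)
  have "is_cocone M J D m p"
    unfolding is_cocone_def
  proof (intro conjI ballI)
    fix u assume u: "u \<in> Arr J"
    have "Comp M (p (Cod J u)) (FAr D u) \<in> homset M (FOb D (Dom J u)) m"
      using Comp_in[OF category functor_hom[OF D homsetI[OF u refl refl]] p] Cod_obj[OF J u] by blast
    then show "Comp M (p (Cod J u)) (FAr D u) = p (Dom J u)"
      using p[OF Dom_obj[OF J u]] by (rule thin)
  qed (use m p in auto)
  moreover have "\<exists>!h. h \<in> homset M m y \<and> (\<forall>j\<in>Obj J. Comp M h (p j) = q j)"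
    if q: "is_cocone M J D y q" for y q
  proof -
    have q': "q j \<in> homset M (FOb D j) y" if "j \<in> Obj J" for j using q that by (simp add: is_cocone_def)
    have "y \<in> Obj M" using q by (simp add: is_cocone_def)
    then have "below m y" using q' by (intro m(3)) (auto simp: below_def)
    then obtain h where h: "h \<in> homset M m y" by (auto simp: below_def)
    have "Comp M h (p j) = q j" if "j \<in> Obj J" for j
      using thin[OF Comp_in[OF category p[OF that] h] q'[OF that]] .
    then show ?thesis using h by (intro ex1I[of _ h] conjI ballI) (auto intro: thin)
  qed
  ultimately have "is_colimit M J D m p" by (simp add: is_colimit_def)
  then show "\<exists>x p. is_colimit M J D x p" by blast
qed

lemma locally_small: "locally_small M"
  using finite_homset small_finite[OF infinite_universe] by (simp add: locally_small_def)

text \<open>A directed diagram in a finite poset attains its colimit at some stage, since an upper bound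
  of finitely many indices that represent all values of the diagram has the greatest value.\<close>

lemma directed_colimit_attained:
  assumes l: "infinite (Field l)" and dir: "directed_poset l A r"
    and D: "is_functor (poset_cat A r) M D" and col: "is_colimit M (poset_cat A r) D x i"
  shows "\<exists>j\<in>A. FOb D j = x"
proof -
  have rA: "r \<subseteq> A \<times> A"
    using dir by (simp add: directed_poset_def partial_order_on_def preorder_on_def)
  have hom: "FAr D (j, j') \<in> homset M (FOb D j) (FOb D j')" if "(j, j') \<in> r" for j j'
    using functor_hom[OF D homsetI[of "(j, j')"]] that by simp
  have "FOb D ` A \<subseteq> Obj M" using functor_ob[OF D] by auto
  then have "finite (FOb D ` A)" using finite_Obj finite_subset by blast
  then obtain B where B: "B \<subseteq> A" "finite B" "FOb D ` A = FOb D ` B"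
    using finite_subset_image[of "FOb D ` A" "FOb D" A] by auto
  obtain m where m: "m \<in> A" "\<And>j. j \<in> B \<Longrightarrow> (j, m) \<in> r" using directed_poset_bound[OF dir l B(1,2)] by blast
  have "\<exists>f. f \<in> homset M (FOb D j) (FOb D m)" if "j \<in> A" for j
  proof -
    obtain j' where j': "j' \<in> B" "FOb D j' = FOb D j" using B(3) \<open>j \<in> A\<close> by (metis imageE imageI)
    then show ?thesis using hom[OF m(2)] by metis
  qed
  then obtain q where q: "\<And>j. j \<in> A \<Longrightarrow> q j \<in> homset M (FOb D j) (FOb D m)" by metis
  have "is_cocone M (poset_cat A r) D (FOb D m) q"
    unfolding is_cocone_def
  proof (intro conjI ballI)
    fix u assume u: "u \<in> Arr (poset_cat A r)"
    then have u': "(fst u, snd u) \<in> r" "fst u \<in> A" "snd u \<in> A" using rA by auto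
    have "Comp M (q (snd u)) (FAr D u) \<in> homset M (FOb D (fst u)) (FOb D m)"
      using Comp_in[OF category hom[OF u'(1)] q[OF u'(3)]] by simp
    then show "Comp M (q (Cod (poset_cat A r) u)) (FAr D u) = q (Dom (poset_cat A r) u)"
      using thin q[OF u'(2)] by simp
  qed (use m functor_ob[OF D] q in auto)
  then obtain h where h: "h \<in> homset M x (FOb D m)" using col unfolding is_colimit_def by blast
  moreover have "i m \<in> homset M (FOb D m) x" using col m(1) by (simp add: is_colimit_def is_cocone_def)
  ultimately show ?thesis using skeletal m(1) by blast
qed

text \<open>Since a directed diagram attains its colimit at a stage \<open>m\<close>, a cocone on its image under
  \<open>Hom (k, -)\<close> is determined by its component at \<open>m\<close>, which is the required factorization.\<close>

lemma presentable:
  assumes k: "k \<in> Obj M" and l: "infinite (Field l)"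
  shows "presentable l M k"
  unfolding presentable_def
proof (intro conjI allI impI k, elim conjE)
  fix A r D x i
  assume dir: "directed_poset l A r" and D: "is_functor (poset_cat A r) M D"
    and col: "is_colimit M (poset_cat A r) D x i"
  let ?P = "poset_cat A r" and ?H = "hom_functor M k"
  have H: "is_functor M set_cat ?H" by (rule is_functor_hom_functor[OF category locally_small k])
  have rA: "r \<subseteq> A \<times> A"
    using dir by (simp add: directed_poset_def partial_order_on_def preorder_on_def)
  have i: "i j \<in> homset M (FOb D j) x" if "j \<in> A" for j
    using col that by (simp add: is_colimit_def is_cocone_def)
  have hom: "FAr D (j, j') \<in> homset M (FOb D j) (FOb D j')" if "(j, j') \<in> r" for j j'
    using functor_hom[OF D homsetI[of "(j, j')"]] that by simp
  obtain m where m: "m \<in> A" "FOb D m = x" using directed_colimit_attained[OF l dir D col] by blast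
  have x: "x \<in> Obj M" using col by (simp add: is_colimit_def is_cocone_def)
  have "is_cocone set_cat ?P (comp_functor ?P ?H D) (FOb ?H x) (\<lambda>j. FAr ?H (i j))"
    unfolding is_cocone_def
  proof (intro conjI ballI)
    show "FOb ?H x \<in> Obj set_cat" by (rule functor_ob[OF H x])
    show "FAr ?H (i j) \<in> homset set_cat (FOb (comp_functor ?P ?H D) j) (FOb ?H x)" if "j \<in> Obj ?P" for j
      using functor_hom[OF H i] that by simp
    fix u assume u: "u \<in> Arr ?P"
    then have u': "(fst u, snd u) \<in> r" "fst u \<in> A" "snd u \<in> A" using rA by auto
    have "Comp M (i (snd u)) (FAr D u) = i (fst u)" using col u by (simp add: is_colimit_def is_cocone_def)
    then show "Comp set_cat (FAr ?H (i (Cod ?P u))) (FAr (comp_functor ?P ?H D) u)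
        = FAr ?H (i (Dom ?P u))"
      using functor_Comp[OF H hom[OF u'(1)] i[OF u'(3)]] u by simp
  qed
  moreover have "\<exists>!h. h \<in> homset set_cat (FOb ?H x) Y \<and> (\<forall>j\<in>Obj ?P. Comp set_cat h (FAr ?H (i j)) = q j)"
    if q: "is_cocone set_cat ?P (comp_functor ?P ?H D) Y q" for Y q
  proof -
    have q1: "q j \<in> homset set_cat (FOb ?H (FOb D j)) Y" if "j \<in> A" for j
      using q that by (simp add: is_cocone_def)
    have q2: "Comp set_cat (q j') (FAr ?H (FAr D (j, j'))) = q j" if "(j, j') \<in> r" for j j'
      using q that by (force simp: is_cocone_def)
    have im: "FAr ?H (i m) = Ide set_cat (FOb ?H x)"
      using thin[OF i[OF m(1)]] Ide_in[OF category x] functor_Ide[OF H x] m(2) by simp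
    have eq: "Comp set_cat (q m) (FAr ?H (i j)) = q j" if j: "j \<in> A" for j
    proof -
      have "finite {j, m}" "{j, m} \<subseteq> A" using j m by auto
      then obtain n where n: "n \<in> A" "(j, n) \<in> r" "(m, n) \<in> r"
        using directed_poset_bound[OF dir l, of "{j, m}"] by auto
      have nx: "FOb D n = x" using skeletal[OF i[OF n(1)]] hom[OF n(3)] m(2) by metis
      have "FAr D (m, n) = Ide M x" using thin hom[OF n(3)] Ide_in[OF category x] nx m(2) by metis
      then have "q m = q n"
        using q2[OF n(3)] functor_Ide[OF H x] Comp_Ide(1)[OF category_set_cat q1[OF n(1)]] nx by simp
      moreover have "FAr D (j, n) = i j" using thin[OF i[OF j]] hom[OF n(2)] nx by metis
      ultimately show ?thesis using q2[OF n(2)] by simp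
    qed
    have uniq: "h = q m"
      if "h \<in> homset set_cat (FOb ?H x) Y" "\<And>j. j \<in> A \<Longrightarrow> Comp set_cat h (FAr ?H (i j)) = q j" for h
      using that(2)[OF m(1)] im Comp_Ide(1)[OF category_set_cat that(1)] by simp
    have "q m \<in> homset set_cat (FOb ?H x) Y" using q1[OF m(1)] m(2) by simp
    then show ?thesis by (intro ex1I[of _ "q m"] conjI ballI uniq) (use eq in auto)
  qed
  ultimately show "is_colimit set_cat ?P (comp_functor ?P ?H D) (FOb ?H x) (\<lambda>j. FAr ?H (i j))"
    by (simp add: is_colimit_def)
qed

lemma locally_presentable: "locally_presentable M"
proof -
  obtain l :: "'u rel" where l: "small_regular_cardinal l"
    using ex_small_regular_cardinal[OF universe] by blast
  then have inf: "infinite (Field l)" by (simp add: small_regular_cardinal_def)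
  have "\<exists>A r D i. small A \<and> directed_poset l A r \<and> is_functor (poset_cat A r) M D \<and>
      (\<forall>j\<in>A. FOb D j \<in> Obj M) \<and> is_colimit M (poset_cat A r) D x i" if x: "x \<in> Obj M" for x
  proof -
    \<comment> \<open>the constant diagram over the poset with one element\<close>
    define D where "D = \<lparr>FOb = (\<lambda>j\<in>{x}. x), FAr = (\<lambda>u\<in>{(x, x)}. Ide M x)\<rparr>"
    note I = Ide_in[OF category x]
    have "is_functor (poset_cat {x} {(x, x)}) M D"
      using x I homsetD[OF I] Comp_Ide(1)[OF category I] by (auto simp: is_functor_def D_def)
    moreover have "is_colimit M (poset_cat {x} {(x, x)}) D x (\<lambda>_. Ide M x)"
      using x I Comp_Ide[OF category] by (auto simp: is_colimit_def is_cocone_def D_def)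
    moreover have "directed_poset l {x} {(x, x)}"
      by (auto simp: directed_poset_def partial_order_on_def preorder_on_def refl_on_def trans_def antisym_def)
    ultimately show ?thesis using x small_finite[OF infinite_universe, of "{x}"]
      by (intro exI[of _ "{x}"] exI[of _ "{(x, x)}"] exI[of _ D] exI[of _ "\<lambda>_. Ide M x"]) (auto simp: D_def)
  qed
  then have "\<exists>S. small S \<and> (\<forall>s\<in>S. presentable l M s) \<and> (\<forall>x\<in>Obj M. \<exists>A r D i. small A \<and>
      directed_poset l A r \<and> is_functor (poset_cat A r) M D \<and> (\<forall>j\<in>A. FOb D j \<in> S) \<and>
      is_colimit M (poset_cat A r) D x i)"
    using presentable[OF _ inf] small_finite[OF infinite_universe finite_Obj]
    by (intro exI[of _ "Obj M"]) blast
  then show ?thesis using category locally_small cocomplete l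
    unfolding locally_presentable_def by blast
qed

lemma combinatorial:
  assumes "model_category M S"
  shows "combinatorial_model_category M S"
proof -
  have "Cof S \<subseteq> Arr M" "Acof S \<subseteq> Arr M" using model_sub[OF assms] by (auto simp: Acof_def)
  moreover from this have "small (Cof S)" "small (Acof S)"
    using finite_Arr finite_subset small_finite[OF infinite_universe] by blast+
  ultimately show ?thesis
    using assms locally_presentable model_lp(2,4)[OF assms]
    unfolding combinatorial_model_category_def by blast
qed

end

section \<open>Model structures on the commutative square\<close>

locale commutative_square =
  fixes M :: "('u, 'u) cat" and a b c d ab cd ac bd :: 'u
  assumes category_M: "category M"
    and Obj_M: "Obj M = {a, b, c, d}"
    and distinct_objects: "distinct [a, b, c, d]"
    and arrows: "ab \<in> homset M a b" "cd \<in> homset M c d" "ac \<in> homset M a c" "bd \<in> homset M b d"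
    and no_arrows: "homset M b a = {}" "homset M c a = {}" "homset M d a = {}" "homset M b c = {}"
      "homset M c b = {}" "homset M d b = {}" "homset M d c = {}"
    and thin_M: "f \<in> homset M x y \<Longrightarrow> g \<in> homset M x y \<Longrightarrow> f = g"
    and uncountable_universe: "uncountable (UNIV :: 'u set)"
begin

lemma objects_neq [simp]:
  "a \<noteq> b" "a \<noteq> c" "a \<noteq> d" "b \<noteq> c" "b \<noteq> d" "c \<noteq> d"
  "b \<noteq> a" "c \<noteq> a" "d \<noteq> a" "c \<noteq> b" "d \<noteq> b" "d \<noteq> c"
  using distinct_objects by auto

sublocale finite_poset_category M
proof
  fix f g x y assume fg: "f \<in> homset M x y" "g \<in> homset M y x"
  then have "x \<in> {a, b, c, d}" "y \<in> {a, b, c, d}" using homset_obj[OF category_M] Obj_M by auto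
  then show "x = y" using fg no_arrows by auto
qed (use category_M Obj_M thin_M in auto)

lemma below_table [simp]:
  "below a a" "below a b" "below a c" "below a d"
  "\<not> below b a" "below b b" "\<not> below b c" "below b d"
  "\<not> below c a" "\<not> below c b" "below c c" "below c d"
  "\<not> below d a" "\<not> below d b" "\<not> below d c" "below d d"
proof -
  have "homset M x x \<noteq> {}" if "x \<in> Obj M" for x using Ide_in[OF category_M that] by blast
  then show "below a a" "below b b" "below c c" "below d d" by (auto simp: below_def Obj_M)
  show "below a b" "below a c" "below b d" "below c d" using arrows by (auto simp: below_def)
  then show "below a d" by (blast intro: below_trans)
qed (use no_arrows in \<open>auto simp: below_def\<close>)

sublocale finite_lattice_category M
proof
  fix X assume X: "X \<subseteq> Obj M"
  show "\<exists>m\<in>Obj M. (\<forall>x\<in>X. below m x) \<and> (\<forall>y\<in>Obj M. (\<forall>x\<in>X. below y x) \<longrightarrow> below y m)"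
  proof (cases "a \<in> X \<or> b \<in> X \<and> c \<in> X")
    case True
    have "below y a" if y: "y \<in> Obj M" "\<forall>x\<in>X. below y x" for y
    proof -
      have "below y a \<or> below y b \<and> below y c" using True y(2) by blast
      then show ?thesis using y(1) Obj_M by auto
    qed
    then show ?thesis using X Obj_M by (intro bexI[of _ a]) auto
  next
    case False
    show ?thesis
    proof (cases "b \<in> X")
      case True
      then show ?thesis using X False Obj_M by (intro bexI[of _ b]) auto
    next
      case nb: False
      show ?thesis
      proof (cases "c \<in> X")
        case True
        then show ?thesis using X nb False Obj_M by (intro bexI[of _ c]) auto
      next
        case nc: False
        then show ?thesis using X nb False Obj_M by (intro bexI[of _ d]) auto
      qed
    qed
  qed
  show "\<exists>m\<in>Obj M. (\<forall>x\<in>X. below x m) \<and> (\<forall>y\<in>Obj M. (\<forall>x\<in>X. below x y) \<longrightarrow> below m y)"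
  proof (cases "d \<in> X \<or> b \<in> X \<and> c \<in> X")
    case True
    have "below d y" if y: "y \<in> Obj M" "\<forall>x\<in>X. below x y" for y
    proof -
      have "below d y \<or> below b y \<and> below c y" using True y(2) by blast
      then show ?thesis using y(1) Obj_M by auto
    qed
    then show ?thesis using X Obj_M by (intro bexI[of _ d]) auto
  next
    case False
    show ?thesis
    proof (cases "b \<in> X")
      case True
      then show ?thesis using X False Obj_M by (intro bexI[of _ b]) auto
    next
      case nb: False
      show ?thesis
      proof (cases "c \<in> X")
        case True
        then show ?thesis using X nb False Obj_M by (intro bexI[of _ c]) auto
      next
        case nc: False
        then show ?thesis using X nb False Obj_M by (intro bexI[of _ a]) auto
      qed
    qed
  qed
qed (rule uncountable_universe)

text \<open>A class of arrows of \<open>M\<close> is described by a relation between objects; lifting, factorization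
  and two-out-of-three then become finite checks on the four objects.\<close>

definition arrows_in :: "('u \<Rightarrow> 'u \<Rightarrow> bool) \<Rightarrow> 'u set" where
  "arrows_in P = {f \<in> Arr M. P (Dom M f) (Cod M f)}"

lemma below_Dom_Cod: "f \<in> Arr M \<Longrightarrow> below (Dom M f) (Cod M f)"
  by (auto simp: below_def homset_def)

lemma all_arrows:
  "(\<forall>f\<in>Arr M. P (Dom M f) (Cod M f)) \<longleftrightarrow> (\<forall>x\<in>Obj M. \<forall>y\<in>Obj M. below x y \<longrightarrow> P x y)"
proof
  assume P: "\<forall>f\<in>Arr M. P (Dom M f) (Cod M f)"
  show "\<forall>x\<in>Obj M. \<forall>y\<in>Obj M. below x y \<longrightarrow> P x y"
    using P by (fastforce simp: below_def homset_def)
next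
  assume P: "\<forall>x\<in>Obj M. \<forall>y\<in>Obj M. below x y \<longrightarrow> P x y"
  show "\<forall>f\<in>Arr M. P (Dom M f) (Cod M f)"
    using P Dom_obj[OF category] Cod_obj[OF category] below_Dom_Cod by simp
qed

lemma wfs_arrows_in:
  assumes L: "\<And>x y. x \<in> Obj M \<Longrightarrow> y \<in> Obj M \<Longrightarrow> below x y \<Longrightarrow> L x y \<longleftrightarrow>
      (\<forall>u\<in>Obj M. \<forall>v\<in>Obj M. below u v \<longrightarrow> R u v \<and> below x u \<and> below y v \<longrightarrow> below y u)"
    and R: "\<And>u v. u \<in> Obj M \<Longrightarrow> v \<in> Obj M \<Longrightarrow> below u v \<Longrightarrow> R u v \<longleftrightarrow>
      (\<forall>x\<in>Obj M. \<forall>y\<in>Obj M. below x y \<longrightarrow> L x y \<and> below x u \<and> below y v \<longrightarrow> below y u)"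
    and F: "\<And>x y. x \<in> Obj M \<Longrightarrow> y \<in> Obj M \<Longrightarrow> below x y \<Longrightarrow>
      (\<exists>z\<in>Obj M. below x z \<and> below z y \<and> L x z \<and> R z y)"
  shows "weak_factorization_system M (arrows_in L) (arrows_in R)"
  unfolding weak_factorization_system_def
proof (intro conjI ballI)
  note ob = Dom_obj[OF category] Cod_obj[OF category]
  have "f \<in> arrows_in L \<longleftrightarrow> f \<in> llp M (arrows_in R)" if f: "f \<in> Arr M" for f
  proof -
    have "f \<in> llp M (arrows_in R) \<longleftrightarrow> (\<forall>r\<in>Arr M. R (Dom M r) (Cod M r) \<and> below (Dom M f) (Dom M r)
        \<and> below (Cod M f) (Cod M r) \<longrightarrow> below (Cod M f) (Dom M r))"
      using f by (simp add: llp_def arrows_in_def has_lifting_iff) blast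
    also have "\<dots> \<longleftrightarrow> (\<forall>u\<in>Obj M. \<forall>v\<in>Obj M. below u v \<longrightarrow> R u v \<and> below (Dom M f) u \<and>
        below (Cod M f) v \<longrightarrow> below (Cod M f) u)"
      by (rule all_arrows[where P = "\<lambda>u v. R u v \<and> below (Dom M f) u \<and> below (Cod M f) v \<longrightarrow> below (Cod M f) u"])
    finally show ?thesis using L[OF ob(1,2)[OF f] below_Dom_Cod[OF f]] f by (simp add: arrows_in_def)
  qed
  then show "arrows_in L = llp M (arrows_in R)" by (auto simp: arrows_in_def llp_def)
  have "f \<in> arrows_in R \<longleftrightarrow> f \<in> rlp M (arrows_in L)" if f: "f \<in> Arr M" for f
  proof -
    have "f \<in> rlp M (arrows_in L) \<longleftrightarrow> (\<forall>l\<in>Arr M. L (Dom M l) (Cod M l) \<and> below (Dom M l) (Dom M f)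
        \<and> below (Cod M l) (Cod M f) \<longrightarrow> below (Cod M l) (Dom M f))"
      using f by (simp add: rlp_def arrows_in_def has_lifting_iff) blast
    also have "\<dots> \<longleftrightarrow> (\<forall>x\<in>Obj M. \<forall>y\<in>Obj M. below x y \<longrightarrow> L x y \<and> below x (Dom M f) \<and>
        below y (Cod M f) \<longrightarrow> below y (Dom M f))"
      by (rule all_arrows[where P = "\<lambda>x y. L x y \<and> below x (Dom M f) \<and> below y (Cod M f) \<longrightarrow> below y (Dom M f)"])
    finally show ?thesis using R[OF ob(1,2)[OF f] below_Dom_Cod[OF f]] f by (simp add: arrows_in_def)
  qed
  then show "arrows_in R = rlp M (arrows_in L)" by (auto simp: arrows_in_def rlp_def)
  fix f assume f: "f \<in> Arr M"
  obtain z where z: "below (Dom M f) z" "below z (Cod M f)" "L (Dom M f) z" "R z (Cod M f)"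
    using F[OF ob(1,2)[OF f] below_Dom_Cod[OF f]] by blast
  obtain l r where lr: "l \<in> homset M (Dom M f) z" "r \<in> homset M z (Cod M f)"
    using z(1,2) by (auto simp: below_def)
  have "f = Comp M r l" using f by (intro thin[OF _ Comp_in[OF category lr]]) (simp add: homset_def)
  then show "\<exists>l\<in>arrows_in L. \<exists>r\<in>arrows_in R. Cod M l = Dom M r \<and> f = Comp M r l"
    using homsetD[OF lr(1)] homsetD[OF lr(2)] z(3,4)
    by (intro bexI[of _ l] bexI[of _ r]) (simp_all add: arrows_in_def)
qed

lemma two_out_of_three_arrows_in:
  assumes "\<And>x y z. x \<in> Obj M \<Longrightarrow> y \<in> Obj M \<Longrightarrow> z \<in> Obj M \<Longrightarrow> below x y \<Longrightarrow> below y z \<Longrightarrow>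
     (W x y \<and> W y z \<longrightarrow> W x z) \<and> (W x y \<and> W x z \<longrightarrow> W y z) \<and> (W y z \<and> W x z \<longrightarrow> W x y)"
  shows "two_out_of_three M (arrows_in W)"
  unfolding two_out_of_three_def
proof (intro ballI impI)
  fix f g assume fg: "f \<in> Arr M" "g \<in> Arr M" "Cod M f = Dom M g"
  then have "f \<in> homset M (Dom M f) (Dom M g)" "g \<in> homset M (Dom M g) (Cod M g)"
    by (auto simp: homset_def)
  note gf = homsetD[OF Comp_in[OF category this]]
  have W: "f \<in> arrows_in W \<longleftrightarrow> W (Dom M f) (Dom M g)" "g \<in> arrows_in W \<longleftrightarrow> W (Dom M g) (Cod M g)"
    "Comp M g f \<in> arrows_in W \<longleftrightarrow> W (Dom M f) (Cod M g)"
    using fg gf by (simp_all add: arrows_in_def)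
  show "(f \<in> arrows_in W \<and> g \<in> arrows_in W \<longrightarrow> Comp M g f \<in> arrows_in W) \<and>
      (f \<in> arrows_in W \<and> Comp M g f \<in> arrows_in W \<longrightarrow> g \<in> arrows_in W) \<and>
      (g \<in> arrows_in W \<and> Comp M g f \<in> arrows_in W \<longrightarrow> f \<in> arrows_in W)"
    unfolding W using fg(3) below_Dom_Cod[OF fg(1)] below_Dom_Cod[OF fg(2)]
    by (intro assms Dom_obj[OF category] Cod_obj[OF category] fg) auto
qed

lemma arrows_in_mono: "(\<And>x y. P x y \<Longrightarrow> Q x y) \<Longrightarrow> arrows_in P \<subseteq> arrows_in Q"
  by (auto simp: arrows_in_def)

definition structure_of ::
  "('u \<Rightarrow> 'u \<Rightarrow> bool) \<Rightarrow> ('u \<Rightarrow> 'u \<Rightarrow> bool) \<Rightarrow> ('u \<Rightarrow> 'u \<Rightarrow> bool) \<Rightarrow> 'u mstruct" where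
  "structure_of W L R = \<lparr>Weq = arrows_in W, Cof = arrows_in L, Fib = arrows_in R\<rparr>"

lemma structure_of_classes:
  "Weq (structure_of W L R) = arrows_in W" "Cof (structure_of W L R) = arrows_in L"
  "Fib (structure_of W L R) = arrows_in R"
  "Acof (structure_of W L R) = arrows_in (\<lambda>x y. L x y \<and> W x y)"
  "Afib (structure_of W L R) = arrows_in (\<lambda>x y. R x y \<and> W x y)"
  by (auto simp: structure_of_def Acof_def Afib_def arrows_in_def)

lemma model_structure_of:
  assumes "two_out_of_three M (arrows_in W)"
    "weak_factorization_system M (arrows_in L) (arrows_in (\<lambda>x y. R x y \<and> W x y))"
    "weak_factorization_system M (arrows_in (\<lambda>x y. L x y \<and> W x y)) (arrows_in R)"
  shows "model_category M (structure_of W L R)"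
proof -
  have "arrows_in W \<subseteq> Arr M" by (auto simp: arrows_in_def)
  then show ?thesis
    using assms category complete cocomplete by (simp add: model_category_def structure_of_classes)
qed

lemma Ide_arrows_in: "Ide M ` Obj M = arrows_in (=)"
proof -
  have "f \<in> Ide M ` Obj M" if "f \<in> Arr M" "Dom M f = Cod M f" for f
  proof -
    have x: "Dom M f \<in> Obj M" using Dom_obj[OF category that(1)] .
    have "f = Ide M (Dom M f)" using that by (intro thin[OF _ Ide_in[OF category x]]) (simp add: homset_def)
    then show ?thesis using x by blast
  qed
  moreover have "f \<in> Arr M \<and> Dom M f = Cod M f" if "f \<in> Ide M ` Obj M" for f
    using that Ide_in[OF category] by (auto simp: homset_def)
  ultimately show ?thesis by (auto simp: arrows_in_def)
qed

lemma singleton_arrows_in: "f \<in> homset M x y \<Longrightarrow> {f} = arrows_in (\<lambda>u v. u = x \<and> v = y)"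
  by (auto simp: arrows_in_def homset_def intro: arr_eqI)

lemma arrows_in_Un: "arrows_in P \<union> arrows_in Q = arrows_in (\<lambda>x y. P x y \<or> Q x y)"
  and arrows_in_Diff: "arrows_in P - arrows_in Q = arrows_in (\<lambda>x y. P x y \<and> \<not> Q x y)"
  and Arr_arrows_in: "Arr M = arrows_in (\<lambda>x y. True)"
  by (auto simp: arrows_in_def)

definition structure1 :: "'u mstruct" where
  "structure1 = \<lparr>Weq = Ide M ` Obj M \<union> {cd}, Cof = Arr M, Fib = Arr M - {cd}\<rparr>"

definition structure2 :: "'u mstruct" where
  "structure2 = \<lparr>Weq = Arr M, Cof = Ide M ` Obj M \<union> {ab, cd}, Fib = Ide M ` Obj M \<union> {ac, bd}\<rparr>"

definition structure3 :: "'u mstruct" where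
  "structure3 = \<lparr>Weq = Arr M, Cof = Arr M, Fib = Ide M ` Obj M\<rparr>"

text \<open>Two common lower bounds of \<open>M\<^sub>1\<close> and \<open>M\<^sub>2\<close> that have no common upper bound below both: the
  first makes \<open>a \<rightarrow> b\<close> and \<open>c \<rightarrow> d\<close> cofibrations, only the identities being acyclic, and the
  second makes \<open>c \<rightarrow> d\<close> an acyclic cofibration.\<close>

definition lower1 :: "'u mstruct" where
  "lower1 = structure_of (\<lambda>x y. x = y \<or> x = a \<and> y = c \<or> x = b \<and> y = d)
     (\<lambda>x y. x = y \<or> x = a \<and> y = b \<or> x = c \<and> y = d) (\<lambda>x y. True)"

definition lower2 :: "'u mstruct" where
  "lower2 = structure_of (\<lambda>x y. True) (\<lambda>x y. x = y \<or> x = c \<and> y = d) (\<lambda>x y. \<not> (x = c \<and> y = d))"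

lemma structure_eqs:
  "structure1 = structure_of (\<lambda>x y. x = y \<or> x = c \<and> y = d) (\<lambda>x y. True) (\<lambda>x y. \<not> (x = c \<and> y = d))"
  "structure2 = structure_of (\<lambda>x y. True) (\<lambda>x y. x = y \<or> x = a \<and> y = b \<or> x = c \<and> y = d)
     (\<lambda>x y. x = y \<or> x = a \<and> y = c \<or> x = b \<and> y = d)"
  "structure3 = structure_of (\<lambda>x y. True) (\<lambda>x y. True) (=)"
proof -
  have 2: "{f, g} = {f} \<union> {g}" for f g :: 'u by blast
  show "structure1 = structure_of (\<lambda>x y. x = y \<or> x = c \<and> y = d) (\<lambda>x y. True) (\<lambda>x y. \<not> (x = c \<and> y = d))"
    "structure2 = structure_of (\<lambda>x y. True) (\<lambda>x y. x = y \<or> x = a \<and> y = b \<or> x = c \<and> y = d)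
     (\<lambda>x y. x = y \<or> x = a \<and> y = c \<or> x = b \<and> y = d)"
    "structure3 = structure_of (\<lambda>x y. True) (\<lambda>x y. True) (=)"
    unfolding structure1_def structure2_def structure3_def structure_of_def 2 Ide_arrows_in
      Arr_arrows_in
    unfolding arrows[THEN singleton_arrows_in] arrows_in_Un arrows_in_Diff
    by simp_all
qed

lemma model_structure1: "model_category M structure1"
  unfolding structure_eqs
  by (intro model_structure_of two_out_of_three_arrows_in wfs_arrows_in;
      unfold Obj_M; elim insertE emptyE; simp)

lemma model_structure2: "model_category M structure2"
  unfolding structure_eqs
  by (intro model_structure_of two_out_of_three_arrows_in wfs_arrows_in;
      unfold Obj_M; elim insertE emptyE; simp)

lemma model_structure3: "model_category M structure3"
  unfolding structure_eqs
  by (intro model_structure_of two_out_of_three_arrows_in wfs_arrows_in;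
      unfold Obj_M; elim insertE emptyE; simp)

lemma model_lower1: "model_category M lower1"
  unfolding lower1_def
  by (intro model_structure_of two_out_of_three_arrows_in wfs_arrows_in;
      unfold Obj_M; elim insertE emptyE; simp)

lemma model_lower2: "model_category M lower2"
  unfolding lower2_def
  by (intro model_structure_of two_out_of_three_arrows_in wfs_arrows_in;
      unfold Obj_M; elim insertE emptyE; simp)

lemma objE:
  assumes "x \<in> Obj M"
  obtains "x = a" | "x = b" | "x = c" | "x = d"
  using assms Obj_M by blast

lemma diagonal_in: "Comp M bd ab \<in> homset M a d" "Comp M cd ac \<in> homset M a d"
  using Comp_in[OF category] arrows by blast+

lemma diagonal_eq: "Comp M cd ac = Comp M bd ab"
  by (rule thin[OF diagonal_in(2,1)])

lemma arrow_cases: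
  assumes f: "f \<in> Arr M"
  shows "iso_arr M f \<or> f \<in> {ab, cd, ac, bd, Comp M bd ab}"
proof -
  have fh: "f \<in> homset M (Dom M f) (Cod M f)" using f by (simp add: homset_def)
  have "Dom M f = Cod M f \<or> (Dom M f, Cod M f) \<in> {(a, b), (c, d), (a, c), (b, d), (a, d)}"
    using below_Dom_Cod[OF f] Dom_obj[OF category f] Cod_obj[OF category f]
    by (elim objE) simp_all
  then show ?thesis
  proof
    assume "Dom M f = Cod M f"
    then show ?thesis using f by (simp add: iso_iff_Ide Ide_arrows_in arrows_in_def)
  next
    assume "(Dom M f, Cod M f) \<in> {(a, b), (c, d), (a, c), (b, d), (a, d)}"
    then have "f \<in> homset M a b \<or> f \<in> homset M c d \<or> f \<in> homset M a c \<or> f \<in> homset M b d \<or> f \<in> homset M a d"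
      using fh by auto
    then show ?thesis using arrows diagonal_in(1) by (auto intro: thin)
  qed
qed

text \<open>Let \<open>p\<close> be a functor to \<open>M\<close> that reflects isomorphisms and maps
  cofibrations to cofibrations of \<open>M\<^sub>2\<close>, and let \<open>h\<close> be a section of it. In a factorization of the
  image under \<open>h\<close> of a vertical arrow into a cofibration and an acyclic fibration, the cofibration
  lies over an identity, since no other cofibration of \<open>M\<^sub>2\<close> is the first factor of a vertical
  arrow. So it is invertible, and \<open>h\<close> sends the vertical arrows to weak equivalences.
  If it does so with \<open>c \<rightarrow> d\<close> as well, then also with \<open>a \<rightarrow> b\<close>, by two-out-of-three. If moreover \<open>h\<close>
  makes \<open>a \<rightarrow> b\<close> a cofibration, then \<open>p\<close> turns it into an acyclic cofibration of \<open>M\<^sub>1\<close>, which it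
  is not.\<close>

lemma no_amalgam:
  assumes S: "model_category C S" and h: "is_functor M C h" and p: "is_functor C M p"
    and ph: "\<And>x. x \<in> Obj M \<Longrightarrow> FOb p (FOb h x) = x"
    and reflect: "\<And>l. l \<in> Arr C \<Longrightarrow> iso_arr M (FAr p l) \<Longrightarrow> iso_arr C l"
    and p_Cof: "FAr p ` Cof S \<subseteq> Cof structure2" and p_Acof: "FAr p ` Acof S \<subseteq> Acof structure1"
    and h_ab: "FAr h ab \<in> Cof S" and h_cd: "FAr h cd \<in> Weq S"
  shows False
proof -
  have vertical: "FAr h f \<in> Weq S" if f: "f \<in> homset M x y" and xy: "x = a \<and> y = c \<or> x = b \<and> y = d" for f x y
  proof -
    have xyo: "x \<in> Obj M" "y \<in> Obj M" using xy Obj_M by auto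
    obtain l r z where lr: "l \<in> Cof S" "r \<in> Afib S" "l \<in> homset C (FOb h x) z"
      "r \<in> homset C z (FOb h y)" "FAr h f = Comp C r l"
      using model_factor_Cof_Afib[OF S functor_hom[OF h f]] .
    have pl: "FAr p l \<in> homset M x (FOb p z)" and pr: "FAr p r \<in> homset M (FOb p z) y"
      using functor_hom[OF p lr(3)] functor_hom[OF p lr(4)] ph xyo by simp_all
    have "FAr p l \<in> Cof structure2" using p_Cof lr(1) by blast
    then have "FOb p z = x \<or> x = a \<and> FOb p z = b \<or> x = c \<and> FOb p z = d"
      using homsetD[OF pl] unfolding structure_eqs structure_of_classes arrows_in_def by auto
    moreover have "below (FOb p z) y" using pr by (auto simp: below_def)
    ultimately have "x = FOb p z" using xy by (elim disjE conjE) simp_all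
    then have "FAr p l \<in> arrows_in (=)" using homsetD[OF pl] by (simp add: arrows_in_def)
    then have "iso_arr C l"
      using reflect homsetD(1)[OF lr(3)] by (simp add: iso_iff_Ide Ide_arrows_in)
    then have "l \<in> Weq S" by (rule model_iso(3)[OF S])
    then show ?thesis using model_two_of_three(1)[OF S lr(3,4)] lr(2,5) by (simp add: Afib_def)
  qed
  have hc: "FAr h cd \<in> homset C (FOb h c) (FOb h d)" "FAr h ac \<in> homset C (FOb h a) (FOb h c)"
    "FAr h ab \<in> homset C (FOb h a) (FOb h b)" "FAr h bd \<in> homset C (FOb h b) (FOb h d)"
    using arrows functor_hom[OF h] by blast+
  have "Comp C (FAr h bd) (FAr h ab) = Comp C (FAr h cd) (FAr h ac)"
    using functor_Comp[OF h arrows(1,4)] functor_Comp[OF h arrows(3,2)] diagonal_eq by simp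
  moreover have "Comp C (FAr h cd) (FAr h ac) \<in> Weq S"
    using model_two_of_three(1)[OF S hc(2,1)] vertical[OF arrows(3)] h_cd by simp
  ultimately have "FAr h ab \<in> Weq S"
    using model_two_of_three(3)[OF S hc(3,4)] vertical[OF arrows(4)] by simp
  then have "FAr p (FAr h ab) \<in> Acof structure1" using h_ab p_Acof by (auto simp: Acof_def)
  moreover have "FAr p (FAr h ab) \<in> homset M a b"
    using functor_hom[OF p hc(3)] ph Obj_M by simp
  ultimately show False
    unfolding structure_eqs structure_of_classes arrows_in_def by (simp add: homset_def)
qed

lemma lower_bounds:
  assumes "T = structure1 \<or> T = structure2 \<or> T = structure3"
  shows "Cof lower1 \<subseteq> Cof T" "Acof lower1 \<subseteq> Acof T" "Cof lower2 \<subseteq> Cof T" "Acof lower2 \<subseteq> Acof T"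
proof -
  have "Cof lower1 \<subseteq> Cof T \<and> Acof lower1 \<subseteq> Acof T \<and> Cof lower2 \<subseteq> Cof T \<and> Acof lower2 \<subseteq> Acof T"
    using assms
  proof (elim disjE)
    assume T: "T = structure1"
    show ?thesis unfolding T structure_eqs lower1_def lower2_def structure_of_classes
      by (intro conjI arrows_in_mono) auto
  next
    assume T: "T = structure2"
    show ?thesis unfolding T structure_eqs lower1_def lower2_def structure_of_classes
      by (intro conjI arrows_in_mono) auto
  next
    assume T: "T = structure3"
    show ?thesis unfolding T structure_eqs lower1_def lower2_def structure_of_classes
      by (intro conjI arrows_in_mono) auto
  qed
  then show "Cof lower1 \<subseteq> Cof T" "Acof lower1 \<subseteq> Acof T" "Cof lower2 \<subseteq> Cof T" "Acof lower2 \<subseteq> Acof T"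
    by simp_all
qed

text \<open>A meet contains both \<open>lower1\<close> and \<open>lower2\<close>, which contradicts \<open>no_amalgam\<close> for the identity
  functors.\<close>

lemma no_meet: "\<nexists>N. is_glb (model_structure_poset M) N {structure1, structure2}"
proof
  assume "\<exists>N. is_glb (model_structure_poset M) N {structure1, structure2}"
  then obtain N where N: "is_glb (model_structure_poset M) N {structure1, structure2}" by blast
  let ?P = "model_structure_poset M"
  have low: "L \<in> Lower ?P {structure1, structure2} \<longleftrightarrow> model_category M L \<and>
      Cof L \<subseteq> Cof structure1 \<and> Acof L \<subseteq> Acof structure1 \<and>
      Cof L \<subseteq> Cof structure2 \<and> Acof L \<subseteq> Acof structure2" for L
    using model_structure1 model_structure2 by (auto simp: Lower_def model_structure_poset_def)
  have "N \<in> Lower ?P {structure1, structure2}" using N by (simp add: greatest_def)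
  then have N': "model_category M N" "Acof N \<subseteq> Acof structure1" "Cof N \<subseteq> Cof structure2"
    by (simp_all add: low)
  have "lower1 \<in> Lower ?P {structure1, structure2}" "lower2 \<in> Lower ?P {structure1, structure2}"
    using model_lower1 model_lower2 lower_bounds by (simp_all add: low)
  then have sub: "Cof lower1 \<subseteq> Cof N" "Acof lower2 \<subseteq> Acof N"
    using N by (simp_all add: greatest_def model_structure_poset_def)
  have "ab \<in> Cof lower1" "cd \<in> Acof lower2"
    using arrows by (auto simp: lower1_def lower2_def structure_of_classes arrows_in_def homset_def)
  then have abcd: "ab \<in> Cof N" "cd \<in> Weq N" using sub by (auto simp: Acof_def)
  have I: "is_functor M M (id_functor M)" by (rule is_functor_id[OF category])
  have im: "FAr (id_functor M) ` X \<subseteq> Y" if "X \<subseteq> Y" "X \<subseteq> Arr M" for X Y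
    using that by (auto simp: subset_iff)
  have "Cof N \<subseteq> Arr M" "Acof N \<subseteq> Arr M" using model_sub[OF N'(1)] by (auto simp: Acof_def)
  then show False
    using no_amalgam[OF N'(1) I I] abcd homsetD(1)[OF arrows(1)] homsetD(1)[OF arrows(2)]
      im[OF N'(2)] im[OF N'(3)] by simp
qed

lemma model_diagonal_Cof:
  assumes S: "model_category M S" and "ab \<in> Cof S" "bd \<in> Cof S"
  shows "Comp M bd ab \<in> Cof S"
proof -
  have "Afib S \<subseteq> Arr M" using model_sub(2)[OF S] by (auto simp: Afib_def)
  moreover have "Cod M ab = Dom M bd" using arrows by (simp add: homset_def)
  ultimately show ?thesis using llp_Comp[OF category _ _ _ , of "Afib S" ab bd] assms(2,3)
    unfolding model_lp(1)[OF S, symmetric] by blast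
qed

text \<open>For \<open>M\<^sub>1\<close> and \<open>M\<^sub>2\<close> the conditions leave open, apart from the identities, only the diagonal.
  It is settled by composition, by two-out-of-three or by a square without a lift.\<close>

lemma structure1_unique:
  assumes S: "model_category M S" and cd: "cd \<in> Acof S"
    and cof: "{ab, ac, bd} \<subseteq> Cof S" and weq: "{ab, ac, bd} \<inter> Weq S = {}"
  shows "S = structure1"
proof (rule model_structure_eqI[OF S model_structure1])
  have "f \<in> Cof S" if "f \<in> Arr M" for f
    using arrow_cases[OF that] model_iso(1)[OF S] cd cof model_diagonal_Cof[OF S]
    by (auto simp: Acof_def)
  then have Cof: "Cof S = Arr M" using model_sub(1)[OF S] by blast
  then show "Cof S = Cof structure1" by (simp add: structure1_def)
  have "Comp M bd ab \<notin> Weq S"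
    using model_two_of_three(3)[OF S arrows(3,2)] weq cd diagonal_eq by (auto simp: Acof_def)
  then have "f \<in> Weq S \<longleftrightarrow> f \<in> Ide M ` Obj M \<union> {cd}" if "f \<in> Arr M" for f
    using arrow_cases[OF that] model_iso(3)[OF S] cd weq by (auto simp: Acof_def iso_iff_Ide[symmetric])
  moreover have "Ide M ` Obj M \<union> {cd} \<subseteq> Arr M"
    using arrows(2) by (auto simp: Ide_arrows_in arrows_in_def homset_def)
  ultimately have "Weq S = Weq structure1"
    using model_sub(3)[OF S] by (auto simp: structure1_def)
  then show "Acof S = Acof structure1" using Cof by (simp add: Acof_def structure1_def)
qed

lemma structure2_unique:
  assumes S: "model_category M S" and acof: "{ab, cd} \<subseteq> Acof S"
    and afib: "{ac, bd} \<subseteq> Afib S" and cof: "{ac, bd} \<inter> Cof S = {}"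
  shows "S = structure2"
proof (rule model_structure_eqI[OF S model_structure2])
  have "Comp M bd ab \<in> Weq S"
    using model_two_of_three(1)[OF S arrows(1,4)] acof afib by (auto simp: Acof_def Afib_def)
  then have "f \<in> Weq S" if "f \<in> Arr M" for f
    using arrow_cases[OF that] model_iso(3)[OF S] acof afib by (auto simp: Acof_def Afib_def)
  then have Weq: "Weq S = Arr M" using model_sub(3)[OF S] by blast
  have "Comp M bd ab \<notin> Cof S"
  proof
    assume "Comp M bd ab \<in> Cof S"
    then have "has_lifting M (Comp M bd ab) bd" using afib unfolding model_lp(1)[OF S] llp_def by blast
    then show False using homsetD[OF arrows(4)] homsetD[OF diagonal_in(1)] by (simp add: has_lifting_iff)
  qed
  then have "f \<in> Cof S \<longleftrightarrow> f \<in> Ide M ` Obj M \<union> {ab, cd}" if "f \<in> Arr M" for f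
    using arrow_cases[OF that] model_iso(1)[OF S] acof cof by (auto simp: Acof_def iso_iff_Ide[symmetric])
  moreover have "Ide M ` Obj M \<union> {ab, cd} \<subseteq> Arr M"
    using arrows(1,2) by (auto simp: Ide_arrows_in arrows_in_def homset_def)
  ultimately show Cof: "Cof S = Cof structure2"
    using model_sub(1)[OF S] by (auto simp: structure2_def)
  then show "Acof S = Acof structure2" using Weq by (simp add: Acof_def structure2_def)
qed

lemma structure3_unique:
  assumes S: "model_category M S" and "Arr M \<subseteq> Acof S"
  shows "S = structure3"
proof (rule model_structure_eqI[OF S model_structure3])
  show "Cof S = Cof structure3" "Acof S = Acof structure3"
    using assms(2) model_sub[OF S] by (auto simp: Acof_def structure3_def)
qed

lemma structure1_iff:
  "model_category M S \<and> cd \<in> Acof S \<and> cd \<notin> Fib S \<and> {ab, ac, bd} \<subseteq> Cof S \<inter> Fib S \<and>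
   {ab, ac, bd} \<inter> Weq S = {} \<longleftrightarrow> S = structure1"
proof
  assume S: "S = structure1"
  show "model_category M S \<and> cd \<in> Acof S \<and> cd \<notin> Fib S \<and> {ab, ac, bd} \<subseteq> Cof S \<inter> Fib S \<and>
      {ab, ac, bd} \<inter> Weq S = {}"
    using model_structure1 homsetD[OF arrows(1)] homsetD[OF arrows(2)] homsetD[OF arrows(3)] homsetD[OF arrows(4)]
    unfolding S structure_eqs structure_of_classes arrows_in_def by simp
qed (blast intro: structure1_unique)

lemma structure2_iff:
  "model_category M S \<and> {ab, cd} \<subseteq> Acof S \<and> {ab, cd} \<inter> Fib S = {} \<and> {ac, bd} \<subseteq> Afib S \<and>
   {ac, bd} \<inter> Cof S = {} \<longleftrightarrow> S = structure2"
proof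
  assume S: "S = structure2"
  show "model_category M S \<and> {ab, cd} \<subseteq> Acof S \<and> {ab, cd} \<inter> Fib S = {} \<and> {ac, bd} \<subseteq> Afib S \<and>
      {ac, bd} \<inter> Cof S = {}"
    using model_structure2 homsetD[OF arrows(1)] homsetD[OF arrows(2)] homsetD[OF arrows(3)] homsetD[OF arrows(4)]
    unfolding S structure_eqs structure_of_classes arrows_in_def by simp
qed (blast intro: structure2_unique)

lemma structure3_iff: "model_category M S \<and> Arr M \<subseteq> Acof S \<longleftrightarrow> S = structure3"
proof
  assume "S = structure3"
  then show "model_category M S \<and> Arr M \<subseteq> Acof S"
    using model_structure3 by (simp add: structure3_def Acof_def)
qed (blast intro: structure3_unique)

end

section \<open>Bilimits of combinatorial model categories\<close>

lemma CMC_simps [simp]: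
  "X \<in> Obj2 CMC \<longleftrightarrow> combinatorial_model_category (fst X) (snd X)"
  "Hom2 CMC X Y = full_subcat (functor_cat (fst X) (fst Y)) {F. left_quillen X Y F}"
  "Ide1 CMC X = id_functor (fst X)"
  "Comp1 CMC X Y Z G F = comp_functor (fst X) G F"
  "HComp CMC X Y Z s t = nt_hcomp (fst X) (fst Z) s t"
  by (auto simp: CMC_def)

lemma cones_simps [simp]:
  "x \<in> Obj (cones T K X Z) \<longleftrightarrow> is_plobj K (\<lambda>k. Hom2 T Z (FOb X k))
       (\<lambda>u. postcomp T Z (FOb X (Dom K u)) (FOb X (Cod K u)) (FAr X u)) x"
  by (simp add: cones_def pseudolim_def)

lemma cones_objD:
  assumes "x \<in> Obj (cones T K X Z)"
  shows "k \<in> Obj K \<Longrightarrow> PlOb x k \<in> Obj (Hom2 T Z (FOb X k))"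
    "PlIso x \<in> extensional (Arr K)"
    "u \<in> Arr K \<Longrightarrow> iso_arr (Hom2 T Z (FOb X (Cod K u))) (PlIso x u)"
    "u \<in> Arr K \<Longrightarrow> PlIso x u \<in> homset (Hom2 T Z (FOb X (Cod K u)))
      (FOb (postcomp T Z (FOb X (Dom K u)) (FOb X (Cod K u)) (FAr X u)) (PlOb x (Dom K u)))
      (PlOb x (Cod K u))"
  using assms by (auto simp: is_plobj_def PiE_iff)

lemma cones_homD:
  assumes "m \<in> homset (cones T K X Z) x y" "k \<in> Obj K"
  shows "PlMap m k \<in> homset (Hom2 T Z (FOb X k)) (PlOb x k) (PlOb y k)"
  using assms by (auto simp: cones_def pseudolim_def is_plarr_def homset_def)

lemma Hom2_CMC_objD:
  assumes "F \<in> Obj (Hom2 CMC X Y)"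
  shows "is_functor (fst X) (fst Y) F" "left_quillen X Y F"
  using assms by auto

lemma left_quillenD:
  assumes "left_quillen X Y F"
  shows "left_adjoint (fst X) (fst Y) F" "FAr F ` Cof (snd X) \<subseteq> Cof (snd Y)"
    "FAr F ` Acof (snd X) \<subseteq> Acof (snd Y)"
  using assms by (auto simp: left_quillen_def)

lemma model_Weq_conjugate:
  assumes S: "model_category C S" and u: "u \<in> homset C x y" and v: "v \<in> homset C x' y'"
    and s: "s \<in> homset C x x'" "iso_arr C s" and t: "t \<in> homset C y y'" "iso_arr C t"
    and sq: "Comp C t u = Comp C v s"
  shows "u \<in> Weq S \<longleftrightarrow> v \<in> Weq S"
proof -
  have "s \<in> Weq S" "t \<in> Weq S" using model_iso(3)[OF S] s t by blast+
  then show ?thesis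
    using model_two_of_three[OF S u t(1)] model_two_of_three[OF S s(1) v] sq by metis
qed

context commutative_square
begin

text \<open>Since \<open>M\<close> is a poset, natural transformations into it are unique and the invertible ones are
  identities. Hence a cone on a diagram of identity functors of \<open>M\<close> is determined by its legs, and
  its legs are equal along each arrow of the diagram.\<close>

lemma cone_eqI:
  fixes x y :: "('k, 'l, 'u endo_func, 'u endo_nt) plobj"
  assumes X: "\<And>k. k \<in> Obj K \<Longrightarrow> fst (FOb X k) = M" and K: "category K"
    and x: "x \<in> Obj (cones CMC K X Z)" and y: "y \<in> Obj (cones CMC K X Z)"
    and eq: "PlOb x = PlOb y"
  shows "x = y"
proof -
  have "PlIso x = PlIso y"
  proof (rule extensionalityI)
    show "PlIso x \<in> extensional (Arr K)" "PlIso y \<in> extensional (Arr K)"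
      using x y by (blast dest: cones_objD(2))+
    fix u assume u: "u \<in> Arr K"
    let ?F = "postcomp CMC Z (FOb X (Dom K u)) (FOb X (Cod K u)) (FAr X u)"
    have "PlIso x u \<in> homset (functor_cat (fst Z) M) (FOb ?F (PlOb x (Dom K u))) (PlOb x (Cod K u))"
      "PlIso y u \<in> homset (functor_cat (fst Z) M) (FOb ?F (PlOb x (Dom K u))) (PlOb x (Cod K u))"
      using cones_objD(4)[OF x u] cones_objD(4)[OF y u] eq X[OF Cod_obj[OF K u]]
      by (simp_all add: homset_full_subcat)
    then show "PlIso x u = PlIso y u" by (rule nt_eq)
  qed
  then show ?thesis using eq by simp
qed

lemma cone_leg_eq:
  assumes X: "\<And>k. k \<in> Obj K \<Longrightarrow> fst (FOb X k) = M" and XF: "\<And>u. u \<in> Arr K \<Longrightarrow> FAr X u = id_functor M"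
    and K: "category K" and Z: "category (fst Z)"
    and x: "x \<in> Obj (cones CMC K X Z)" and u: "u \<in> Arr K"
  shows "PlOb x (Dom K u) = PlOb x (Cod K u)"
proof -
  let ?p = "PlOb x (Dom K u)" and ?q = "PlOb x (Cod K u)"
  have p: "?p \<in> Obj (Hom2 CMC Z (FOb X (Dom K u)))"
    using cones_objD(1)[OF x Dom_obj[OF K u]] .
  have "comp_functor (fst Z) (id_functor M) ?p = ?p"
    using id_comp_functor[OF Z _ category] Hom2_CMC_objD(1)[OF p] X[OF Dom_obj[OF K u]] by simp
  then have "FOb (postcomp CMC Z (FOb X (Dom K u)) (FOb X (Cod K u)) (FAr X u)) ?p = ?p"
    using p XF[OF u] by (simp add: postcomp_def)
  then have i: "iso_arr (Hom2 CMC Z (FOb X (Cod K u))) (PlIso x u)"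
    "PlIso x u \<in> homset (Hom2 CMC Z (FOb X (Cod K u))) ?p ?q"
    using cones_objD(3,4)[OF x u] by simp_all
  obtain t where "t \<in> homset (Hom2 CMC Z (FOb X (Cod K u))) ?q ?p" using iso_arrE[OF i] by blast
  then show ?thesis
    using i(2) functors_eq_if_nts[OF _ _ Z] X[OF Cod_obj[OF K u]] by (auto simp: homset_full_subcat)
qed

lemma identity_cone:
  assumes X: "\<And>k. k \<in> Obj K \<Longrightarrow> FOb X k = (M, T k)" and XF: "\<And>u. u \<in> Arr K \<Longrightarrow> FAr X u = id_functor M"
    and K: "category K"
    and L: "\<And>k. k \<in> Obj K \<Longrightarrow> left_quillen (M, L) (M, T k) (id_functor M)"
  shows "\<lparr>PlOb = (\<lambda>k\<in>Obj K. id_functor M), PlIso = (\<lambda>u\<in>Arr K. Ide (functor_cat M M) (id_functor M))\<rparr>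
    \<in> Obj (cones CMC K X (M, L))"
proof -
  let ?I = "id_functor M" and ?i = "Ide (functor_cat M M) (id_functor M)"
  have I: "is_functor M M ?I" by (rule is_functor_id[OF category])
  have i: "?i \<in> homset (functor_cat M M) ?I ?I" by (rule nt_Ide[OF category category I])
  have ii: "Comp (functor_cat M M) ?i ?i = ?i"
    using Comp_Ide(1)[OF category Ide_in[OF category]]
    by (auto simp: functor_cat_def intro!: restrict_ext)
  have iso: "iso_arr (Hom2 CMC (M, L) (FOb X k)) ?i" "?i \<in> homset (Hom2 CMC (M, L) (FOb X k)) ?I ?I"
    if k: "k \<in> Obj K" for k
  proof -
    show *: "?i \<in> homset (Hom2 CMC (M, L) (FOb X k)) ?I ?I"
      using i X[OF k] L[OF k] by (simp add: homset_full_subcat)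
    show "iso_arr (Hom2 CMC (M, L) (FOb X k)) ?i"
      by (rule iso_arrI[OF * *]) (simp_all add: X[OF k] ii)
  qed
  have ob: "?I \<in> Obj (Hom2 CMC (M, L) (FOb X k))" if k: "k \<in> Obj K" for k
    using X[OF k] L[OF k] I by simp
  have arr: "?i \<in> Arr (Hom2 CMC (M, L) (FOb X k))" if k: "k \<in> Obj K" for k
    using iso(2)[OF k] by (rule homsetD)
  have "Comp M (FAr ?I (Ide M x)) (Ide M x) = Ide M x" if x: "x \<in> Obj M" for x
    using Comp_Ide(1)[OF category Ide_in[OF category x]] homsetD(1)[OF Ide_in[OF category x]] by simp
  then have hc: "nt_hcomp M M ?i ?i = ?i"
    by (auto simp: nt_hcomp_def functor_cat_def comp_functor_id[OF category] intro!: restrict_ext)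
  have post: "FOb (postcomp CMC (M, L) (FOb X (Dom K u)) (FOb X (Cod K u)) (FAr X u)) ?I = ?I"
    "FAr (postcomp CMC (M, L) (FOb X (Dom K u)) (FOb X (Cod K u)) (FAr X u)) ?i = ?i"
    if u: "u \<in> Arr K" for u
    using ob[OF Dom_obj[OF K u]] arr[OF Dom_obj[OF K u]] XF[OF u] X[OF Dom_obj[OF K u]] X[OF Cod_obj[OF K u]]
    by (simp_all add: postcomp_def comp_functor_id[OF category] hc)
  show ?thesis
    unfolding cones_simps is_plobj_def
  proof (intro conjI ballI impI)
    fix u assume u: "u \<in> Arr K"
    show "iso_arr (Hom2 CMC (M, L) (FOb X (Cod K u))) (PlIso \<lparr>PlOb = (\<lambda>k\<in>Obj K. ?I), PlIso = (\<lambda>u\<in>Arr K. ?i)\<rparr> u)"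
      using iso(1)[OF Cod_obj[OF K u]] u by simp
    show "PlIso \<lparr>PlOb = (\<lambda>k\<in>Obj K. ?I), PlIso = (\<lambda>u\<in>Arr K. ?i)\<rparr> u
      \<in> homset (Hom2 CMC (M, L) (FOb X (Cod K u)))
         (FOb (postcomp CMC (M, L) (FOb X (Dom K u)) (FOb X (Cod K u)) (FAr X u))
           (PlOb \<lparr>PlOb = (\<lambda>k\<in>Obj K. ?I), PlIso = (\<lambda>u\<in>Arr K. ?i)\<rparr> (Dom K u)))
         (PlOb \<lparr>PlOb = (\<lambda>k\<in>Obj K. ?I), PlIso = (\<lambda>u\<in>Arr K. ?i)\<rparr> (Cod K u))"
      using iso(2)[OF Cod_obj[OF K u]] u post(1)[OF u] Dom_obj[OF K u] Cod_obj[OF K u] by simp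
  next
    fix u v assume u: "u \<in> Arr K" and v: "v \<in> Arr K" and uv: "Cod K u = Dom K v"
    have "Comp K v u \<in> Arr K" 
      using homsetD(1)[OF Comp_in[OF K homsetI[OF u refl refl] homsetI[OF v uv[symmetric] refl]]] .
    then show "PlIso \<lparr>PlOb = (\<lambda>k\<in>Obj K. ?I), PlIso = (\<lambda>u\<in>Arr K. ?i)\<rparr> (Comp K v u) =
        Comp (Hom2 CMC (M, L) (FOb X (Cod K v)))
          (PlIso \<lparr>PlOb = (\<lambda>k\<in>Obj K. ?I), PlIso = (\<lambda>u\<in>Arr K. ?i)\<rparr> v)
          (FAr (postcomp CMC (M, L) (FOb X (Dom K v)) (FOb X (Cod K v)) (FAr X v))
            (PlIso \<lparr>PlOb = (\<lambda>k\<in>Obj K. ?I), PlIso = (\<lambda>u\<in>Arr K. ?i)\<rparr> u))"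
      using u v post(2)[OF v] X[OF Cod_obj[OF K v]] ii by simp
  next
    fix k assume k: "k \<in> Obj K"
    show "PlIso \<lparr>PlOb = (\<lambda>k\<in>Obj K. ?I), PlIso = (\<lambda>u\<in>Arr K. ?i)\<rparr> (Ide K k) =
        Ide (Hom2 CMC (M, L) (FOb X k)) (PlOb \<lparr>PlOb = (\<lambda>k\<in>Obj K. ?I), PlIso = (\<lambda>u\<in>Arr K. ?i)\<rparr> k)"
      using k homsetD(1)[OF Ide_in[OF K k]] X[OF k] by simp
  qed (use ob in \<open>auto simp del: CMC_simps\<close>)
qed

text \<open>The diagram may have any shape with a weakly terminal object \<open>k\<^sub>0\<close>; this covers the cospan and
  its copy inside the universe. Suppose that \<open>(C, S)\<close> is the vertex of a bilimit. The legs are all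
  the same functor \<open>p\<close> to \<open>M\<close>. The identity cone with vertex \<open>(M, lower1)\<close> and the one with
  vertex \<open>(M, lower2)\<close> lift to left Quillen functors \<open>h\<^sub>1\<close> and \<open>h\<^sub>2\<close> into \<open>(C, S)\<close>, which are
  sections of \<open>p\<close>. Out of \<open>C\<close> with its least model structure, both the identity and
  \<open>h\<^sub>1 p\<close> are left Quillen; they restrict to the same cone, so they are isomorphic. Hence \<open>p\<close>
  reflects isomorphisms. The isomorphism also compares the images of \<open>c \<rightarrow> d\<close> under \<open>h\<^sub>1\<close> and
  \<open>h\<^sub>2\<close>: the second is a weak equivalence, so the first is one too. This is the situation
  that \<open>no_amalgam\<close> excludes.\<close>

lemma no_bilimit:
  assumes X: "\<And>k. k \<in> Obj K \<Longrightarrow> FOb X k = (M, T k)"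
    and T: "\<And>k. k \<in> Obj K \<Longrightarrow> T k = structure1 \<or> T k = structure2 \<or> T k = structure3"
    and XF: "\<And>u. u \<in> Arr K \<Longrightarrow> FAr X u = id_functor M"
    and K: "category K"
    and k1: "k1 \<in> Obj K" "T k1 = structure1" and k2: "k2 \<in> Obj K" "T k2 = structure2"
    and k0: "k0 \<in> Obj K" "\<And>k. k \<in> Obj K \<Longrightarrow> \<exists>u\<in>Arr K. Dom K u = k \<and> Cod K u = k0"
  shows "\<not> is_bilimit CMC K X Y w"
proof
  assume bil: "is_bilimit CMC K X Y w"
  obtain C S where Y: "Y = (C, S)" by (cases Y)
  have "combinatorial_model_category C S" using bil Y by (simp add: is_bilimit_def)
  then have S: "model_category C S" and lp: "locally_presentable C"
    by (simp_all add: combinatorial_model_category_def)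
  then have C: "category C" and compl: "complete_cat C" by (simp_all add: model_category_def)
  have fstX: "fst (FOb X k) = M" if "k \<in> Obj K" for k using X[OF that] by simp
  have w: "w \<in> Obj (cones CMC K X Y)" using bil by (simp add: is_bilimit_def)
  define p where "p = PlOb w k0"
  have pk: "PlOb w k = p" if k: "k \<in> Obj K" for k
    using k0(2)[OF k] cone_leg_eq[OF fstX XF K _ w] C Y unfolding p_def by auto
  have pq: "left_quillen (C, S) (M, T k) p" if k: "k \<in> Obj K" for k
  proof -
    have "PlOb w k \<in> Obj (Hom2 CMC Y (FOb X k))" using cones_objD(1)[OF w k] .
    then show ?thesis using pk[OF k] X[OF k] Y by simp
  qed
  have pl: "left_adjoint C M p" using left_quillenD(1)[OF pq[OF k0(1)]] by simp
  then have p: "is_functor C M p" by (rule left_adjoint_functor)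
  have equiv: "is_equivalence (Hom2 CMC Z Y) (cones CMC K X Z) (induced_functor CMC K X Y w Z)"
    if "Z \<in> Obj2 CMC" for Z
    using bil that by (simp add: is_bilimit_def)
  have "\<exists>h. left_quillen (M, L) (C, S) h \<and> comp_functor M p h = id_functor M"
    if L: "model_category M L" "\<And>k. k \<in> Obj K \<Longrightarrow> left_quillen (M, L) (M, T k) (id_functor M)" for L
  proof -
    have Z: "(M, L) \<in> Obj2 CMC" using combinatorial[OF L(1)] by simp
    obtain h m m' where h: "h \<in> Obj (Hom2 CMC (M, L) Y)"
      and m: "m \<in> homset (cones CMC K X (M, L)) (FOb (induced_functor CMC K X Y w (M, L)) h)
          \<lparr>PlOb = (\<lambda>k\<in>Obj K. id_functor M), PlIso = (\<lambda>u\<in>Arr K. Ide (functor_cat M M) (id_functor M))\<rparr>"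
      and m': "m' \<in> homset (cones CMC K X (M, L))
          \<lparr>PlOb = (\<lambda>k\<in>Obj K. id_functor M), PlIso = (\<lambda>u\<in>Arr K. Ide (functor_cat M M) (id_functor M))\<rparr>
          (FOb (induced_functor CMC K X Y w (M, L)) h)"
      by (rule equivalence_surj[OF equiv[OF Z] identity_cone[OF X XF K L(2)]])
    have "PlOb (FOb (induced_functor CMC K X Y w (M, L)) h) k0 = comp_functor M p h"
      using h k0(1) by (simp add: induced_functor_def restrict_cone_def p_def)
    then have "comp_functor M p h = id_functor M"
      using cones_homD[OF m k0(1)] cones_homD[OF m' k0(1)] k0(1) X[OF k0(1)]
      by (intro functors_eq_if_nts[OF _ _ category]) (auto simp: homset_full_subcat)
    then show ?thesis using Hom2_CMC_objD(2)[OF h] Y by blast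
  qed note lift = this
  have "left_quillen (M, lower1) (M, T k) (id_functor M)" "left_quillen (M, lower2) (M, T k) (id_functor M)"
    if k: "k \<in> Obj K" for k
    using left_quillen_id[OF category _ lower_bounds(1,2)[OF T[OF k]]] model_sub(1)[OF model_lower1]
      left_quillen_id[OF category _ lower_bounds(3,4)[OF T[OF k]]] model_sub(1)[OF model_lower2] by simp_all
  then obtain h1 h2 where h1: "left_quillen (M, lower1) (C, S) h1" "comp_functor M p h1 = id_functor M"
    and h2: "left_quillen (M, lower2) (C, S) h2" "comp_functor M p h2 = id_functor M"
    using lift[OF model_lower1] lift[OF model_lower2] by blast
  have h1l: "left_adjoint M C h1" and h2l: "left_adjoint M C h2"
    using left_quillenD(1)[OF h1(1)] left_quillenD(1)[OF h2(1)] by simp_all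
  have h1f: "is_functor M C h1" and h2f: "is_functor M C h2"
    using h1l h2l left_adjoint_functor by blast+
  have ph1: "FOb p (FOb h1 x) = x" if "x \<in> Obj M" for x
    using arg_cong[OF h1(2), of "\<lambda>F. FOb F x"] that by simp
  have ph2: "FAr p (FAr h2 f) = f" if "f \<in> Arr M" for f
    using arg_cong[OF h2(2), of "\<lambda>F. FAr F f"] that by simp
  let ?Z = "(C, least_structure C)"
  have Z: "?Z \<in> Obj2 CMC" using least_structure_combinatorial[OF lp compl] by simp
  \<comment> \<open>\<open>g\<close> need not be left Quillen for \<open>S\<close> itself, so it is compared with the identity over the
    least model structure.\<close>
  define g where "g = comp_functor C h1 p"
  have gl: "left_adjoint C C g" unfolding g_def by (rule left_adjoint_comp[OF C category C pl h1l])
  then have gf: "is_functor C C g" by (rule left_adjoint_functor)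
  have g: "g \<in> Obj (Hom2 CMC ?Z Y)"
    using left_quillen_from_least[OF S gl C] gf Y by simp
  have i: "id_functor C \<in> Obj (Hom2 CMC ?Z Y)"
    using left_quillen_from_least[OF S left_adjoint_id[OF C] C] is_functor_id[OF C] Y by simp
  let ?R = "induced_functor CMC K X Y w ?Z"
  have R: "is_functor (Hom2 CMC ?Z Y) (cones CMC K X ?Z) ?R"
    using equiv[OF Z] by (simp add: is_equivalence_def)
  have "comp_functor C p g = comp_functor C p (id_functor C)"
    by (rule functor_eq[OF is_functor_comp[OF C gf p] is_functor_comp[OF C is_functor_id[OF C] p] C])
      (simp add: g_def ph1 functor_ob[OF p])
  then have eqR: "PlOb (FOb ?R g) = PlOb (FOb ?R (id_functor C))"
    using g i pk by (auto simp: induced_functor_def restrict_cone_def intro!: restrict_ext)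
  have "FOb ?R g = FOb ?R (id_functor C)"
    by (rule cone_eqI[OF fstX K functor_ob[OF R g] functor_ob[OF R i] eqR])
  then obtain q s t where s: "s \<in> homset (Hom2 CMC ?Z Y) q g" "iso_arr (Hom2 CMC ?Z Y) s"
    and t: "t \<in> homset (Hom2 CMC ?Z Y) q (id_functor C)" "iso_arr (Hom2 CMC ?Z Y) t"
    by (rule equivalence_inj[OF equiv[OF Z] g i])
  have s': "s \<in> homset (functor_cat C C) q g" and t': "t \<in> homset (functor_cat C C) q (id_functor C)"
    using s(1) t(1) Y by (simp_all add: homset_full_subcat)
  have q: "is_functor C C q" by (rule nt_functors(1)[OF s'])
  have si: "iso_arr C (NMap s x)" and ti: "iso_arr C (NMap t x)" if x: "x \<in> Obj C" for x
    using iso_nt_component[of C C "{F. left_quillen ?Z Y F}" s q g x]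
      iso_nt_component[of C C "{F. left_quillen ?Z Y F}" t q "id_functor C" x] s t x Y by simp_all
  have conj_iso: "iso_arr C (FAr g l) \<longleftrightarrow> iso_arr C l" and conj_Weq: "FAr g l \<in> Weq S \<longleftrightarrow> l \<in> Weq S"
    if l: "l \<in> homset C x y" for l x y
  proof -
    have xy: "x \<in> Obj C" "y \<in> Obj C" using homset_obj[OF C l] .
    note ql = functor_hom[OF q l] and gl = functor_hom[OF gf l]
      and s1 = nt_hom[OF s' xy(1)] si[OF xy(1)] nt_hom[OF s' xy(2)] si[OF xy(2)] nt_natural[OF s' l]
    have t1: "NMap t x \<in> homset C (FOb q x) x" "iso_arr C (NMap t x)"
      "NMap t y \<in> homset C (FOb q y) y" "iso_arr C (NMap t y)"
      "Comp C (NMap t y) (FAr q l) = Comp C l (NMap t x)"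
      using nt_hom[OF t' xy(1)] nt_hom[OF t' xy(2)] ti xy nt_natural[OF t' l] homsetD(1)[OF l] by simp_all
    show "iso_arr C (FAr g l) \<longleftrightarrow> iso_arr C l"
      using iso_conjugate[OF C ql gl s1] iso_conjugate[OF C ql l t1] by simp
    show "FAr g l \<in> Weq S \<longleftrightarrow> l \<in> Weq S"
      using model_Weq_conjugate[OF S ql gl s1] model_Weq_conjugate[OF S ql l t1] by simp
  qed
  have reflect: "iso_arr C l" if l: "l \<in> Arr C" "iso_arr M (FAr p l)" for l
  proof -
    have lh: "l \<in> homset C (Dom C l) (Cod C l)" using l(1) by (simp add: homset_def)
    have "iso_arr C (FAr h1 (FAr p l))" using functor_iso[OF category h1f functor_hom[OF p lh] l(2)] .
    then show ?thesis using conj_iso[OF lh] l(1) by (simp add: g_def)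
  qed
  have low: "ab \<in> Cof lower1" "cd \<in> Acof lower2"
    using arrows by (auto simp: lower1_def lower2_def structure_of_classes arrows_in_def homset_def)
  have h2cd: "FAr h2 cd \<in> homset C (FOb h2 c') (FOb h2 d)" if "c' = Dom M cd" for c'
    using functor_hom[OF h2f arrows(2)] homsetD(2)[OF arrows(2)] that by simp
  have "FAr h2 cd \<in> Weq S" using left_quillenD(3)[OF h2(1)] low(2) by (auto simp: Acof_def)
  then have "FAr g (FAr h2 cd) \<in> Weq S" using conj_Weq[OF h2cd[OF refl]] by simp
  then have h1cd: "FAr h1 cd \<in> Weq S"
    using ph2[OF homsetD(1)[OF arrows(2)]] homsetD(1)[OF h2cd[OF refl]] by (simp add: g_def)
  show False
  proof (rule no_amalgam[OF S h1f p ph1 reflect])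
    show "FAr p ` Cof S \<subseteq> Cof structure2" using left_quillenD(2)[OF pq[OF k2(1)]] k2(2) by simp
    show "FAr p ` Acof S \<subseteq> Acof structure1" using left_quillenD(3)[OF pq[OF k1(1)]] k1(2) by simp
    show "FAr h1 ab \<in> Cof S" using left_quillenD(2)[OF h1(1)] low(1) by auto
    show "FAr h1 cd \<in> Weq S" by (rule h1cd)
  qed
qed

end

section \<open>The cospan of identity functors\<close>

lemma category_poset_cat:
  assumes "partial_order_on A r"
  shows "category (poset_cat A r)"
  using assms
  by (auto simp: category_def homset_def partial_order_on_def preorder_on_def refl_on_def
      dest: transD)

lemma category_walking_cospan: "category walking_cospan"
  unfolding walking_cospan_def
  by (rule category_poset_cat)
    (auto simp: partial_order_on_def preorder_on_def refl_on_def trans_def antisym_def)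

text \<open>The existence of all bilimits speaks of index categories whose objects and arrows lie in the
  universe, so the cospan is copied there.\<close>

definition copy_cat :: "('o \<Rightarrow> 'p) \<Rightarrow> ('m \<Rightarrow> 'n) \<Rightarrow> ('o, 'm) cat \<Rightarrow> ('p, 'n) cat" where
  "copy_cat f g C =
     \<lparr>Obj = f ` Obj C, Arr = g ` Arr C, Dom = (\<lambda>u. f (Dom C (inv g u))),
      Cod = (\<lambda>u. f (Cod C (inv g u))), Ide = (\<lambda>x. g (Ide C (inv f x))),
      Comp = (\<lambda>v u. g (Comp C (inv g v) (inv g u)))\<rparr>"

lemma category_copy:
  assumes "category C" "inj f" "inj g"
  shows "category (copy_cat f g C)"
  using assms by (auto simp: category_def copy_cat_def homset_def inj_eq)

lemma UNIV_cospan: "(UNIV :: cospan set) = {Leg1, Apex, Leg2}"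
  using cospan.exhaust by auto

lemma finite_UNIV_cospan: "finite (UNIV :: cospan set)"
  by (simp add: UNIV_cospan)

lemma ex_inj_finite:
  assumes "finite (UNIV :: 'a set)" "infinite (UNIV :: 'b set)"
  shows "\<exists>f :: 'a \<Rightarrow> 'b. inj f"
  using finite_lepoll_infinite[OF assms(2,1)] by (auto simp: lepoll_def)

context commutative_square
begin

definition leg :: "cospan \<Rightarrow> 'u mstruct" where
  "leg = case_cospan structure1 structure3 structure2"

lemma leg_simps [simp]: "leg Leg1 = structure1" "leg Apex = structure3" "leg Leg2 = structure2"
  by (simp_all add: leg_def)

lemma leg_cases: "leg k = structure1 \<or> leg k = structure2 \<or> leg k = structure3"
  by (cases k) simp_all

lemma model_leg: "model_category M (leg k)"
  by (cases k) (simp_all add: model_structure1 model_structure2 model_structure3)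

lemma left_quillen_leg:
  assumes "x = y \<or> y = Apex"
  shows "left_quillen (M, leg x) (M, leg y) (id_functor M)"
proof -
  have "Cof (leg x) \<subseteq> Arr M" using model_sub(1)[OF model_leg] .
  moreover have "Cof (leg x) \<subseteq> Cof (leg y) \<and> Acof (leg x) \<subseteq> Acof (leg y)"
    using assms model_sub(1)[OF model_leg, of x] by (auto simp: structure3_def Acof_def)
  ultimately show ?thesis by (intro left_quillen_id category) auto
qed

lemma identity_diagram:
  assumes K: "category K" and X: "\<And>k. k \<in> Obj K \<Longrightarrow> FOb X k = (M, leg (e k))"
    and XF: "\<And>u. u \<in> Arr K \<Longrightarrow> FAr X u = id_functor M"
    and e: "\<And>u. u \<in> Arr K \<Longrightarrow> e (Dom K u) = e (Cod K u) \<or> e (Cod K u) = Apex"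
  shows "is_diagram CMC K X"
  unfolding is_diagram_def
proof (intro conjI ballI impI)
  show "FOb X k \<in> Obj2 CMC" if "k \<in> Obj K" for k
    using X[OF that] combinatorial[OF model_leg] by simp
  show "FAr X u \<in> Obj (Hom2 CMC (FOb X (Dom K u)) (FOb X (Cod K u)))" if u: "u \<in> Arr K" for u
    using X[OF Dom_obj[OF K u]] X[OF Cod_obj[OF K u]] XF[OF u] left_quillen_leg[OF e[OF u]]
      is_functor_id[OF category] by simp
  show "FAr X (Ide K k) = Ide1 CMC (FOb X k)" if k: "k \<in> Obj K" for k
    using X[OF k] XF homsetD(1)[OF Ide_in[OF K k]] by simp
  show "FAr X (Comp K v u) = Comp1 CMC (FOb X (Dom K u)) (FOb X (Cod K u)) (FOb X (Cod K v)) (FAr X v) (FAr X u)"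
    if u: "u \<in> Arr K" and v: "v \<in> Arr K" and uv: "Cod K u = Dom K v" for u v
    using homsetD(1)[OF Comp_in[OF K homsetI[OF u refl refl] homsetI[OF v uv[symmetric] refl]]]
      XF u v X[OF Dom_obj[OF K u]] comp_functor_id[OF category] by simp
qed

lemma cospan_diagram: "is_diagram CMC walking_cospan (id_cospan M structure1 structure2 structure3)"
  by (rule identity_diagram[OF category_walking_cospan, where e = "\<lambda>k. k"])
    (auto simp: id_cospan_def leg_def walking_cospan_def split: cospan.split)

lemma cospan_no_bilimit:
  "\<not> is_bilimit CMC walking_cospan (id_cospan M structure1 structure2 structure3) Y w"
proof (rule no_bilimit[OF _ leg_cases _ category_walking_cospan, where ?k1.0 = Leg1 and ?k2.0 = Leg2 and ?k0.0 = Apex])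
  show "FOb (id_cospan M structure1 structure2 structure3) k = (M, leg k)" for k
    by (cases k) (simp_all add: id_cospan_def)
qed (auto simp: id_cospan_def walking_cospan_def)

lemma no_bilimits: "\<not> CMC_has_bilimits TYPE('u)"
proof
  assume *: "CMC_has_bilimits TYPE('u)"
  obtain f :: "cospan \<Rightarrow> 'u" where f: "inj f"
    using ex_inj_finite[OF finite_UNIV_cospan infinite_universe] by blast
  have "finite (UNIV :: (cospan \<times> cospan) set)"
    using finite_UNIV_cospan finite_cartesian_product by (simp add: UNIV_Times_UNIV[symmetric] del: UNIV_Times_UNIV)
  then obtain g :: "cospan \<times> cospan \<Rightarrow> 'u" where g: "inj g"
    using ex_inj_finite[OF _ infinite_universe] by blast
  define K where "K = copy_cat f g walking_cospan"
  define X :: "('u, 'u, 'u model_cat, 'u endo_func) func"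
    where "X = \<lparr>FOb = (\<lambda>k. (M, leg (inv f k))), FAr = (\<lambda>_. id_functor M)\<rparr>"
  have K: "category K" unfolding K_def by (rule category_copy[OF category_walking_cospan f g])
  have "finite (Obj K)" "finite (Arr K)"
    using finite_UNIV_cospan \<open>finite (UNIV :: (cospan \<times> cospan) set)\<close> finite_subset[OF subset_UNIV]
    by (auto simp: K_def copy_cat_def)
  then have "small_category K"
    using K small_finite[OF infinite_universe] by (simp add: small_category_def)
  moreover have "is_diagram CMC K X"
    by (rule identity_diagram[OF K, where e = "inv f"])
      (use f g in \<open>auto simp: X_def K_def copy_cat_def walking_cospan_def\<close>)
  ultimately obtain Y w where "is_bilimit CMC K X Y w" using * unfolding CMC_has_bilimits_def by blast
  moreover have "\<not> is_bilimit CMC K X Y w"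
  proof (rule no_bilimit[OF _ leg_cases _ K, where ?k1.0 = "f Leg1" and ?k2.0 = "f Leg2" and ?k0.0 = "f Apex"])
    show "\<exists>u\<in>Arr K. Dom K u = k \<and> Cod K u = f Apex" if "k \<in> Obj K" for k
    proof -
      obtain x where x: "k = f x" using \<open>k \<in> Obj K\<close> by (auto simp: K_def copy_cat_def)
      then show ?thesis using f g
        by (intro bexI[of _ "g (x, Apex)"]) (auto simp: K_def copy_cat_def walking_cospan_def)
    qed
  qed (use f in \<open>auto simp: X_def K_def copy_cat_def walking_cospan_def\<close>)
  ultimately show False by blast
qed

end

section \<open>The square as a product of two arrows\<close>

lemma walking_square_simps:
  "Obj (prod_cat walking_arrow walking_arrow) = UNIV"
  "f \<in> homset (prod_cat walking_arrow walking_arrow) p q \<longleftrightarrow>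
     f = ((fst p, fst q), (snd p, snd q)) \<and> fst p \<le> fst q \<and> snd p \<le> snd q"
  by (cases f; cases p; cases q; auto simp: prod_cat_def walking_arrow_def homset_def)+

lemma commutative_square_of_iso:
  fixes M :: "('u, 'u) cat"
    and E :: "(bool \<times> bool, (bool \<times> bool) \<times> (bool \<times> bool), 'u, 'u) func"
  assumes universe: "uncountable (UNIV :: 'u set)"
    and M: "category M" and iso: "iso_functor (prod_cat walking_arrow walking_arrow) M E"
    and objects: "a = FOb E (False, False)" "b = FOb E (True, False)"
      "c = FOb E (False, True)" "d = FOb E (True, True)"
    and arrows: "ab \<in> homset M a b" "cd \<in> homset M c d" "ac \<in> homset M a c" "bd \<in> homset M b d"
  shows "commutative_square M a b c d ab cd ac bd"
proof -
  let ?P = "prod_cat walking_arrow walking_arrow"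
  obtain G where E: "is_functor ?P M E" and G: "is_functor M ?P G"
    and GE: "comp_functor ?P G E = id_functor ?P" and EG: "comp_functor M E G = id_functor M"
    using iso by (auto simp: iso_functor_def)
  have GE': "FOb G (FOb E p) = p" for p
    using arg_cong[OF GE, of "\<lambda>F. FOb F p"] by (simp add: walking_square_simps)
  have EG': "FOb E (FOb G x) = x" if "x \<in> Obj M" for x
    using arg_cong[OF EG, of "\<lambda>F. FOb F x"] that by simp
  have EGf: "FAr E (FAr G f) = f" if "f \<in> Arr M" for f
    using arg_cong[OF EG, of "\<lambda>F. FAr F f"] that by simp
  have hom: "fst p \<le> fst q \<and> snd p \<le> snd q" if "f \<in> homset M (FOb E p) (FOb E q)" for f p q
    using functor_hom[OF G that] unfolding GE' walking_square_simps by blast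
  show ?thesis
  proof
    show "Obj M = {a, b, c, d}"
    proof
      show "Obj M \<subseteq> {a, b, c, d}"
      proof
        fix x assume x: "x \<in> Obj M"
        obtain i j where "FOb G x = (i, j)" by (cases "FOb G x")
        then show "x \<in> {a, b, c, d}" using EG'[OF x] objects by (cases i; cases j) auto
      qed
      show "{a, b, c, d} \<subseteq> Obj M"
        using functor_ob[OF E] objects by (simp add: walking_square_simps)
    qed
    have inj: "FOb E p = FOb E q \<longleftrightarrow> p = q" for p q using GE' by metis
    show "distinct [a, b, c, d]" by (simp add: objects inj)
    show "homset M b a = {}" "homset M c a = {}" "homset M d a = {}" "homset M b c = {}"
      "homset M c b = {}" "homset M d b = {}" "homset M d c = {}"
      unfolding objects using hom by force+
    fix f g x y assume fg: "f \<in> homset M x y" "g \<in> homset M x y"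
    have "FAr G f = FAr G g"
      using functor_hom[OF G fg(1)] functor_hom[OF G fg(2)] unfolding walking_square_simps by simp
    then show "f = g" using EGf homsetD(1)[OF fg(1)] homsetD(1)[OF fg(2)] by metis
  qed (use M arrows universe in auto)
qed

theorem mainTheorem2:
  fixes M :: "('u, 'u) cat"
    and E :: "(bool \<times> bool, (bool \<times> bool) \<times> (bool \<times> bool), 'u, 'u) func"
    and a b c d ab cd ac bd :: 'u
    and M1 M2 M3 :: "'u mstruct"
  assumes universe: "uncountable (UNIV :: 'u set)"
    and square: "category M" "iso_functor (prod_cat walking_arrow walking_arrow) M E"
    and objects: "a = FOb E (False, False)" "b = FOb E (True, False)"
      "c = FOb E (False, True)" "d = FOb E (True, True)"
    and arrows: "ab \<in> homset M a b" "cd \<in> homset M c d" "ac \<in> homset M a c" "bd \<in> homset M b d"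
    and M1: "M1 = \<lparr>Weq = Ide M ` Obj M \<union> {cd}, Cof = Arr M, Fib = Arr M - {cd}\<rparr>"
    and M2: "M2 = \<lparr>Weq = Arr M, Cof = Ide M ` Obj M \<union> {ab, cd}, Fib = Ide M ` Obj M \<union> {ac, bd}\<rparr>"
    and M3: "M3 = \<lparr>Weq = Arr M, Cof = Arr M, Fib = Ide M ` Obj M\<rparr>"
  shows "(\<forall>S. model_category M S \<and> cd \<in> Acof S \<and> cd \<notin> Fib S \<and>
           {ab, ac, bd} \<subseteq> Cof S \<inter> Fib S \<and> {ab, ac, bd} \<inter> Weq S = {} \<longleftrightarrow> S = M1) \<and>
         (\<forall>S. model_category M S \<and> {ab, cd} \<subseteq> Acof S \<and> {ab, cd} \<inter> Fib S = {} \<and>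
           {ac, bd} \<subseteq> Afib S \<and> {ac, bd} \<inter> Cof S = {} \<longleftrightarrow> S = M2) \<and>
         (\<forall>S. model_category M S \<and> Arr M \<subseteq> Acof S \<longleftrightarrow> S = M3) \<and>
         Order.partial_order (model_structure_poset M) \<and>
         (\<nexists>N. is_glb (model_structure_poset M) N {M1, M2}) \<and>
         left_quillen (M, M1) (M, M3) (id_functor M) \<and>
         left_quillen (M, M2) (M, M3) (id_functor M) \<and>
         is_diagram CMC walking_cospan (id_cospan M M1 M2 M3) \<and>
         (\<nexists>Y k. is_bilimit CMC walking_cospan (id_cospan M M1 M2 M3) Y k) \<and>
         \<not> CMC_has_bilimits TYPE('u)"
proof -
  interpret commutative_square M a b c d ab cd ac bd
    by (rule commutative_square_of_iso[OF universe square objects arrows])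
  have eqs: "M1 = structure1" "M2 = structure2" "M3 = structure3"
    unfolding M1 M2 M3 structure1_def structure2_def structure3_def by (rule refl)+
  have "left_quillen (M, structure1) (M, structure3) (id_functor M)"
    "left_quillen (M, structure2) (M, structure3) (id_functor M)"
    using left_quillen_leg[of Leg1 Apex] left_quillen_leg[of Leg2 Apex] by simp_all
  then show ?thesis
    unfolding eqs
    by (intro conjI allI structure1_iff structure2_iff structure3_iff model_structure_partial_order
        no_meet cospan_diagram no_bilimits) (simp_all add: cospan_no_bilimit)
qed

end
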